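(* Let $(X,\rho)$ be a compact metric space and $f\colon X\to X$ a continuous map. Let $K_0,K_1$ be disjoint compact subsets of $X$ and let $J\subset\mathbb{N}$ be a completely deterministic set with $\underline{d}(J)>0$. Let $\bar x\in X$ and suppose there is $\omega\in\Omega_2$ which is a generic point for the Bernoulli measure $\xi_{1/2}$ and satisfies $f^j(\bar x)\in K_{\omega_j}$ for every $j\in J$. Then every $\mu\in V(\bar x)$ satisfies $$h_\mu(f)\ge\underline{d}(J)\cdot\log 2>0.$$
   Context: $\Omega_M=\{0,\dots,M-1\}^{\mathbb{Z}}$ with the product topology and shift $\sigma$, $(\sigma\omega)_i=\omega_{i+1}$. For a continuous map $T\colon Z\to Z$ of a compact metric space, $z\in Z$ and $n\ge1$, let $\mu_n(z,T)=\frac1n\sum_{i=0}^{n-1}\delta_{T^i(z)}$. A point $z$ generates an invariant measure $\mu$ if $\mu$ is a weak$^*$ limit of $\mu_{n_k}(z,T)$ along some strictly increasing sequence $(n_k)$; $V(z)$ is the set of measures generated by $z$; $z$ is a generic point for $\mu$ if $V(z)=\{\mu\}$. The Bernoulli measure $\xi_{1/2}$ on $\Omega_2$ is the shift-invariant measure giving each cylinder $\{\omega:\omega_0=u_1,\dots,\omega_{N-1}=u_N\}$ measure $2^{-N}$. For $J\subset\mathbb{Z}$, $\bar d(J)=\limsup_{N\to\infty}\frac1N\#(J\cap[0,N-1])$, $\underline d(J)$ is the corresponding $\liminf$, and $d(J)$ is their common value when they agree. A set $J\subset\mathbb{Z}$ (or $\subset\mathbb{N}$) is completely deterministic if its characteristic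 sequence $\chi_J\in\Omega_2$ ($(\chi_J)_i=1$ iff $i\in J$) satisfies $h_\nu(\sigma)=0$ for every $\nu\in V(\chi_J)$ (w.r.t. $\sigma$). $h_\mu(f)$ is metric entropy. *)

theory Defs
  imports "HOL-Probability.Probability"
begin

text \<open>A point z of a compact set Z (inside a metric space type) generates the Borel
probability measure mu (concentrated on Z) w.r.t. T if mu is a weak-star limit of the
empirical measures mu_n(z,T) = (1/n) sum_{i<n} delta_{T^i z} along a strictly
increasing sequence n_k.  The integral of g against mu_n(z,T) is written out as
(1/n) sum_{i<n} g(T^i z); test functions are the continuous real functions on Z.\<close>

definition generates ::
  "('a::metric_space \<Rightarrow> 'a) \<Rightarrow> 'a set \<Rightarrow> 'a \<Rightarrow> 'a measure \<Rightarrow> bool" where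
  "generates T Z z \<mu> \<longleftrightarrow>
     (\<exists>r::nat \<Rightarrow> nat. strict_mono r \<and>
        (\<forall>g::'a \<Rightarrow> real. continuous_on Z g \<longrightarrow>
           (\<lambda>k. (\<Sum>i<r k. g ((T ^^ i) z)) / real (r k))
             \<longlonglongrightarrow> (\<integral>x. indicator Z x * g x \<partial>\<mu>)))"

definition prob_on :: "'a::metric_space set \<Rightarrow> 'a measure \<Rightarrow> bool" where
  "prob_on Z \<mu> \<longleftrightarrow> sets \<mu> = sets borel \<and> prob_space \<mu> \<and> emeasure \<mu> Z = 1"

definition Vgen ::
  "('a::metric_space \<Rightarrow> 'a) \<Rightarrow> 'a set \<Rightarrow> 'a \<Rightarrow> 'a measure set" where
  "Vgen T Z z = {\<mu>. prob_on Z \<mu> \<and> generates T Z z \<mu>}"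

definition generic_point ::
  "('a::metric_space \<Rightarrow> 'a) \<Rightarrow> 'a set \<Rightarrow> 'a \<Rightarrow> 'a measure \<Rightarrow> bool" where
  "generic_point T Z z \<mu> \<longleftrightarrow> Vgen T Z z = {\<mu>}"

definition is_fin_partition :: "'a measure \<Rightarrow> 'a set set \<Rightarrow> bool" where
  "is_fin_partition \<mu> P \<longleftrightarrow> finite P \<and> P \<subseteq> sets \<mu> \<and> \<Union>P = space \<mu> \<and>
     (\<forall>A\<in>P. \<forall>B\<in>P. A \<noteq> B \<longrightarrow> A \<inter> B = {})"

definition part_entropy :: "'a measure \<Rightarrow> 'a set set \<Rightarrow> real" where
  "part_entropy \<mu> P = (\<Sum>A\<in>P. if measure \<mu> A = 0 then 0
                                else - measure \<mu> A * ln (measure \<mu> A))"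

definition join_iter :: "('a \<Rightarrow> 'a) \<Rightarrow> 'a set set \<Rightarrow> nat \<Rightarrow> 'a set set" where
  "join_iter T P n =
     {(\<Inter>i<n. (T ^^ i) -` (a i)) | a. \<forall>i<n. a i \<in> P} - {{}}"

definition entropy_part :: "'a measure \<Rightarrow> ('a \<Rightarrow> 'a) \<Rightarrow> 'a set set \<Rightarrow> real" where
  "entropy_part \<mu> T P = lim (\<lambda>n. part_entropy \<mu> (join_iter T P n) / real n)"

definition metric_entropy :: "'a measure \<Rightarrow> ('a \<Rightarrow> 'a) \<Rightarrow> ereal" where
  "metric_entropy \<mu> T =
     (SUP P\<in>{P. is_fin_partition \<mu> P}. ereal (entropy_part \<mu> T P))"

text \<open>Omega_2 is realised as the compact subset {0,1}^Z of the metric (product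
topology) space int => real.\<close>
definition Omega2 :: "(int \<Rightarrow> real) set" where
  "Omega2 = {\<omega>. \<forall>i. \<omega> i \<in> {0, 1}}"

definition shift :: "(int \<Rightarrow> real) \<Rightarrow> (int \<Rightarrow> real)" where
  "shift \<omega> = (\<lambda>i. \<omega> (i + 1))"

definition bernoulli_half :: "(int \<Rightarrow> real) measure \<Rightarrow> bool" where
  "bernoulli_half \<xi> \<longleftrightarrow> prob_on Omega2 \<xi> \<and>
     (\<forall>A\<in>sets \<xi>. emeasure \<xi> (shift -` A) = emeasure \<xi> A) \<and>
     (\<forall>u::real list. set u \<subseteq> {0,1} \<longrightarrow>
        measure \<xi> {\<omega>. \<forall>i<length u. \<omega> (int i) = u ! i} = (1/2) ^ length u)"

definition lower_density :: "nat set \<Rightarrow> real" where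
  "lower_density J =
     real_of_ereal (liminf (\<lambda>N. ereal (real (card (J \<inter> {..<N})) / real N)))"

definition char_seq :: "nat set \<Rightarrow> (int \<Rightarrow> real)" where
  "char_seq J = (\<lambda>i. if 0 \<le> i \<and> nat i \<in> J then 1 else 0)"

definition completely_deterministic :: "nat set \<Rightarrow> bool" where
  "completely_deterministic J \<longleftrightarrow>
     (\<forall>\<nu>\<in>Vgen shift Omega2 (char_seq J). metric_entropy \<nu> shift = 0)"

end

theory Submission
  imports Defs
begin

text \<open>Separate \<open>K 0\<close> from \<open>K 1\<close> by a superlevel set \<open>P = {x. h x > c}\<close> of a Urysohn function, with
  \<open>c\<close> chosen such that \<open>{x. h x = c}\<close> is null. For \<open>t\<close> uniform on \<open>{..<r k}\<close> consider the words of
  length \<open>n\<close> read from time \<open>t\<close> on in \<open>\<omega>\<close>, in the itinerary of \<open>xbar\<close> with respect to \<open>P\<close>, and in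
  the characteristic sequence of \<open>J\<close>. The last two determine the first up to one bit per zero
  of the third word, so that
  \<open>H(\<omega>-word) \<le> H(P-word) + H(J-word) + E(number of zeros) * ln 2\<close>.
  By compactness, \<open>r\<close> can be thinned out such that \<open>\<omega>\<close> and \<open>J\<close> also generate measures along it;
  these are the Bernoulli measure and some \<open>\<nu>\<close> of entropy zero. Letting \<open>k\<close> and then \<open>n\<close> tend
  to infinity, after division by \<open>n\<close>, gives
  \<open>ln 2 \<le> h(\<mu>, {P, - P}) + 0 + (1 - lower_density J) * ln 2\<close>. No joint limit of the three words
  is needed.\<close>

subsection \<open>Entropy of words\<close>

text \<open>The law of the random variable \<open>X t\<close> for \<open>t\<close> drawn uniformly
  from \<open>I\<close>.\<close>

definition freq :: "'i set \<Rightarrow> ('i \<Rightarrow> 's) \<Rightarrow> 's \<Rightarrow> real" where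
  "freq I X s = real (card {t\<in>I. X t = s}) / real (card I)"

lemma sum_over_values:
  assumes "finite I"
  shows "(\<Sum>t\<in>I. F (X t)) = real (card I) * (\<Sum>s\<in>X ` I. freq I X s * F s)"
proof (cases "I = {}")
  case False
  with assms have c: "real (card I) > 0" by (simp add: card_gt_0_iff)
  have "(\<Sum>t\<in>I. F (X t)) = (\<Sum>s\<in>X ` I. \<Sum>t\<in>{t\<in>I. X t = s}. F (X t))"
    by (rule sum.image_gen[OF assms])
  also have "\<dots> = (\<Sum>s\<in>X ` I. real (card {t\<in>I. X t = s}) * F s)"
    by (intro sum.cong) auto
  also have "\<dots> = real (card I) * (\<Sum>s\<in>X ` I. freq I X s * F s)"
    using c by (simp add: freq_def sum_distrib_left)
  finally show ?thesis .
qed simp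

lemma freq_nonneg: "0 \<le> freq I X s"
  by (simp add: freq_def)

lemma freq_pos: "finite I \<Longrightarrow> t \<in> I \<Longrightarrow> 0 < freq I X (X t)"
  by (auto simp: freq_def card_gt_0_iff intro!: divide_pos_pos)

lemma freq_eq_0: "s \<notin> X ` I \<Longrightarrow> freq I X s = 0"
proof -
  assume "s \<notin> X ` I"
  then have e: "{t\<in>I. X t = s} = {}" by auto
  show ?thesis unfolding freq_def e by simp
qed

lemma freq_mono:
  assumes "finite I" "\<And>t. t \<in> I \<Longrightarrow> X t = s \<Longrightarrow> Y t = s'"
  shows "freq I X s \<le> freq I Y s'"
  unfolding freq_def using assms
  by (intro divide_right_mono of_nat_mono card_mono) auto

lemma sum_freq:
  assumes "finite I" "I \<noteq> {}"
  shows "(\<Sum>s\<in>X ` I. freq I X s) = 1"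
  using sum_over_values[OF assms(1), of "\<lambda>_. 1" X] assms by (simp add: card_gt_0_iff)

text \<open>Gibbs' inequality with sums over samples \<open>t\<close> instead of values. By
  \<open>ln_le_minus_one\<close> the left side exceeds the right one by at most the sum of
  \<open>q (X t) / freq I X (X t) - 1\<close>; grouping by values turns the quotients into
  \<open>card I\<close> times the total weight of \<open>q\<close>.\<close>

lemma gibbs_freq:
  assumes I: "finite I" and q: "\<And>t. t \<in> I \<Longrightarrow> 0 < q (X t)"
    and le: "(\<Sum>s\<in>X ` I. q s) \<le> 1"
  shows "(\<Sum>t\<in>I. - ln (freq I X (X t))) \<le> (\<Sum>t\<in>I. - ln (q (X t)))"
proof -
  have "(\<Sum>t\<in>I. ln (q (X t)) - ln (freq I X (X t))) \<le> (\<Sum>t\<in>I. q (X t) / freq I X (X t) - 1)"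
  proof (intro sum_mono)
    fix t assume t: "t \<in> I"
    have "ln (q (X t) / freq I X (X t)) \<le> q (X t) / freq I X (X t) - 1"
      using freq_pos[OF I t, of X] q[OF t] by (intro ln_le_minus_one) simp
    then show "ln (q (X t)) - ln (freq I X (X t)) \<le> q (X t) / freq I X (X t) - 1"
      using freq_pos[OF I t, of X] q[OF t] by (simp add: ln_div)
  qed
  also have "\<dots> = (\<Sum>t\<in>I. q (X t) / freq I X (X t)) - real (card I)"
    by (simp add: sum_subtractf)
  also have "(\<Sum>t\<in>I. q (X t) / freq I X (X t))
      = real (card I) * (\<Sum>s\<in>X ` I. freq I X s * (q s / freq I X s))"
    by (rule sum_over_values[OF I])
  also have "(\<Sum>s\<in>X ` I. freq I X s * (q s / freq I X s)) = (\<Sum>s\<in>X ` I. q s)"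
    by (intro sum.cong refl) (auto simp: less_imp_neq[OF freq_pos[OF I], symmetric])
  also have "real (card I) * (\<Sum>s\<in>X ` I. q s) - real (card I) \<le> 0"
    using mult_left_mono[OF le, of "real (card I)"] by simp
  finally show ?thesis by (simp add: sum_subtractf sum_negf)
qed

section \<open>Binary words and the entropy of a law on them\<close>

definition words :: "nat \<Rightarrow> bool list set" where
  "words n = {u. length u = n}"

lemma in_words [simp]: "u \<in> words n \<longleftrightarrow> length u = n"
  by (simp add: words_def)

lemma words_eq: "words n = {u. set u \<subseteq> UNIV \<and> length u = n}"
  by (simp add: words_def)

lemma finite_words [simp]: "finite (words n)"
  unfolding words_eq by (rule finite_lists_length_eq) simp

lemma card_words: "card (words n) = 2 ^ n"
  unfolding words_eq by (subst card_lists_length_eq) auto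

lemma words_0: "words 0 = {[]}"
  by (auto simp: words_def)

lemma words_Suc: "words (Suc n) = (#) False ` words n \<union> (#) True ` words n"
proof -
  have "u \<in> (#) False ` words n \<union> (#) True ` words n" if "u \<in> words (Suc n)" for u
    using that by (cases u; cases "hd u") (auto simp: words_def)
  then show ?thesis by (auto simp: words_def)
qed

text \<open>Entropy in natural logarithms. A word with \<open>p u = 0\<close> contributes 0 without
  a case distinction, since \<open>0 * ln 0 = 0\<close>.\<close>

definition word_entropy :: "(bool list \<Rightarrow> real) \<Rightarrow> nat \<Rightarrow> real" where
  "word_entropy p n = (\<Sum>u\<in>words n. - (p u * ln (p u)))"

definition zeros :: "bool list \<Rightarrow> nat" where
  "zeros y = length (filter Not y)"

text \<open>A position where \<open>y\<close> is true is forced by \<open>v\<close>; every other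
  position is free and doubles the count.\<close>

lemma card_agreeing_words:
  "length v = length y \<Longrightarrow>
   card {w \<in> words (length y). \<forall>i<length y. y ! i \<longrightarrow> w ! i = v ! i} = 2 ^ zeros y"
proof (induction v y rule: list_induct2)
  case Nil
  then show ?case by (simp add: words_0 zeros_def)
next
  case (Cons a v b y)
  let ?A = "{w \<in> words (length y). \<forall>i<length y. y ! i \<longrightarrow> w ! i = v ! i}"
  have fin: "finite ?A" by (rule finite_subset[OF _ finite_words[of "length y"]]) auto
  have eq: "{w \<in> words (length (b # y)). \<forall>i<length (b # y). (b # y) ! i \<longrightarrow> w ! i = (a # v) ! i}
     = (if b then (#) a ` ?A else (#) False ` ?A \<union> (#) True ` ?A)"
    by (cases a) (auto simp: words_Suc All_less_Suc2 image_iff)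
  have "card ((#) False ` ?A \<union> (#) True ` ?A) = card ?A + card ?A"
    using fin by (subst card_Un_disjoint) (auto simp: card_image)
  then show ?case
    unfolding eq using Cons.IH by (auto simp: card_image zeros_def)
qed

lemma freq_word_entropy:
  assumes I: "finite I" "I \<noteq> {}" and X: "\<And>t. t \<in> I \<Longrightarrow> length (X t) = n"
  shows "(\<Sum>t\<in>I. - ln (freq I X (X t))) = real (card I) * word_entropy (freq I X) n"
proof -
  have "(\<Sum>s\<in>X ` I. freq I X s * - ln (freq I X s)) = word_entropy (freq I X) n"
    unfolding word_entropy_def
  proof (rule sum.mono_neutral_cong_left)
    show "X ` I \<subseteq> words n" using X by (auto simp: words_def)
    show "\<forall>u\<in>words n - X ` I. - (freq I X u * ln (freq I X u)) = 0"
      by (auto simp: freq_eq_0)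
  qed auto
  then show ?thesis using sum_over_values[OF I(1), of "\<lambda>s. - ln (freq I X s)" X] by simp
qed

text \<open>A word \<open>W t\<close> that agrees with \<open>N t\<close> wherever \<open>Y t\<close> is true is determined by
  \<open>N t\<close>, \<open>Y t\<close> and one further bit for each false entry of \<open>Y t\<close>.\<close>

lemma entropy_of_agreeing_words:
  assumes I: "finite I" "I \<noteq> {}"
    and W: "\<And>t. t \<in> I \<Longrightarrow> length (W t) = n"
    and N: "\<And>t. t \<in> I \<Longrightarrow> length (N t) = n"
    and Y: "\<And>t. t \<in> I \<Longrightarrow> length (Y t) = n"
    and agree: "\<And>t i. t \<in> I \<Longrightarrow> i < n \<Longrightarrow> Y t ! i \<Longrightarrow> W t ! i = N t ! i"
  shows "word_entropy (freq I W) n \<le> word_entropy (freq I N) n + word_entropy (freq I Y) n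
           + (\<Sum>t\<in>I. real (zeros (Y t))) / real (card I) * ln 2"
proof -
  have c: "real (card I) > 0" using I by (simp add: card_gt_0_iff)
  define X where "X = (\<lambda>t. ((N t, Y t), W t))"
  \<comment> \<open>The reference law \<open>q\<close> draws \<open>N\<close> and \<open>Y\<close>
    independently from their own laws and then picks uniformly among the \<open>2 ^ zeros y\<close>
    words compatible with them. Its cross entropy is the right-hand side of the claim.\<close>
  define q where "q = (\<lambda>s :: (bool list \<times> bool list) \<times> bool list. freq I N (fst (fst s)) * freq I Y (snd (fst s)) / 2 ^ zeros (snd (fst s)))"
  define ag where "ag = (\<lambda>(v, y). {w \<in> words (length y). \<forall>i<length y. y ! i \<longrightarrow> w ! i = v ! i})"
  have fin_ag: "finite (ag vy)" for vy
    by (rule finite_subset[OF _ finite_words[of "length (snd vy)"]]) (auto simp: ag_def)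
  have qpos: "q (X t) > 0" if "t \<in> I" for t
    using that I freq_pos[of I t N] freq_pos[of I t Y] by (simp add: q_def X_def)
  \<comment> \<open>By \<open>agree\<close>, every sampled value lies in the set of compatible
    triples. There \<open>q\<close> sums to 1, fibre by fibre.\<close>
  have "(\<Sum>s\<in>X ` I. q s) \<le> (\<Sum>s\<in>Sigma (N ` I \<times> Y ` I) ag. q s)"
  proof (rule sum_mono2)
    show "finite (Sigma (N ` I \<times> Y ` I) ag)" using I fin_ag by auto
    show "X ` I \<subseteq> Sigma (N ` I \<times> Y ` I) ag"
      using W N Y agree by (auto simp: X_def ag_def words_def)
    show "0 \<le> q b" for b by (simp add: q_def freq_nonneg)
  qed
  also have "\<dots> = (\<Sum>vy\<in>N ` I \<times> Y ` I. \<Sum>w\<in>ag vy. q (vy, w))"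
    using I fin_ag by (subst sum.Sigma) auto
  also have "\<dots> = (\<Sum>vy\<in>N ` I \<times> Y ` I. freq I N (fst vy) * freq I Y (snd vy))"
  proof (rule sum.cong[OF refl])
    fix vy assume vy: "vy \<in> N ` I \<times> Y ` I"
    then have "card (ag vy) = 2 ^ zeros (snd vy)"
      using card_agreeing_words[of "fst vy" "snd vy"] N Y by (auto simp: ag_def)
    then show "(\<Sum>w\<in>ag vy. q (vy, w)) = freq I N (fst vy) * freq I Y (snd vy)"
      by (simp add: q_def)
  qed
  also have "\<dots> = (\<Sum>v\<in>N ` I. freq I N v) * (\<Sum>y\<in>Y ` I. freq I Y y)"
    by (simp add: sum_product sum.cartesian_product case_prod_unfold)
  also have "\<dots> = 1" using I by (simp add: sum_freq)
  finally have "(\<Sum>t\<in>I. - ln (freq I X (X t))) \<le> (\<Sum>t\<in>I. - ln (q (X t)))"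
    by (intro gibbs_freq I qpos)
  \<comment> \<open>Forgetting \<open>N\<close> and \<open>Y\<close> cannot increase entropy: a
    joint value is at most as frequent as its last component.\<close>
  moreover have "(\<Sum>t\<in>I. - ln (freq I W (W t))) \<le> (\<Sum>t\<in>I. - ln (freq I X (X t)))"
  proof (intro sum_mono)
    fix t assume t: "t \<in> I"
    have "freq I X (X t) \<le> freq I W (W t)"
      by (rule freq_mono[OF I(1)]) (simp add: X_def)
    then show "- ln (freq I W (W t)) \<le> - ln (freq I X (X t))"
      using freq_pos[OF I(1) t, of X] by simp
  qed
  moreover have "(\<Sum>t\<in>I. - ln (q (X t)))
    = (\<Sum>t\<in>I. - ln (freq I N (N t))) + (\<Sum>t\<in>I. - ln (freq I Y (Y t)))
      + (\<Sum>t\<in>I. real (zeros (Y t))) * ln 2"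
    unfolding sum_distrib_right sum.distrib[symmetric]
  proof (rule sum.cong[OF refl])
    fix t assume t: "t \<in> I"
    show "- ln (q (X t)) = - ln (freq I N (N t)) + - ln (freq I Y (Y t)) + real (zeros (Y t)) * ln 2"
      using freq_pos[OF I(1) t, of N] freq_pos[OF I(1) t, of Y]
      by (simp add: q_def X_def ln_div ln_mult ln_realpow)
  qed
  ultimately have "real (card I) * word_entropy (freq I W) n
    \<le> real (card I) * word_entropy (freq I N) n + real (card I) * word_entropy (freq I Y) n
      + (\<Sum>t\<in>I. real (zeros (Y t))) * ln 2"
    using freq_word_entropy[OF I W] freq_word_entropy[OF I N] freq_word_entropy[OF I Y] by simp
  then show ?thesis using c by (simp add: field_simps)
qed

section \<open>Entropy rate of stationary laws on binary words\<close>

lemma gibbs: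
  fixes p q :: "'s \<Rightarrow> real"
  assumes p: "\<And>s. s \<in> S \<Longrightarrow> 0 \<le> p s" and q: "\<And>s. s \<in> S \<Longrightarrow> 0 \<le> q s"
    and pq: "\<And>s. s \<in> S \<Longrightarrow> 0 < p s \<Longrightarrow> 0 < q s" and le: "sum q S \<le> sum p S"
  shows "(\<Sum>s\<in>S. - (p s * ln (p s))) \<le> (\<Sum>s\<in>S. - (p s * ln (q s)))"
proof -
  have "(\<Sum>s\<in>S. p s * ln (q s) - p s * ln (p s)) \<le> (\<Sum>s\<in>S. q s - p s)"
  proof (intro sum_mono)
    fix s assume s: "s \<in> S"
    show "p s * ln (q s) - p s * ln (p s) \<le> q s - p s"
    proof (cases "p s = 0")
      case False
      with p[OF s] have pp: "p s > 0" by simp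
      with pq[OF s] have qp: "q s > 0" by simp
      have "p s * ln (q s / p s) \<le> p s * (q s / p s - 1)"
        using pp qp by (intro mult_left_mono ln_le_minus_one) auto
      then show ?thesis using pp qp by (simp add: ln_div algebra_simps)
    qed (use q[OF s] in simp)
  qed
  then show ?thesis using le by (simp add: sum_subtractf sum_negf)
qed

text \<open>The cylinder probabilities of a shift-invariant measure on binary sequences:
  \<open>extend\<close> is Kolmogorov consistency and \<open>stationary\<close> is invariance under
  the shift.\<close>

locale stationary_law =
  fixes p :: "bool list \<Rightarrow> real"
  assumes nonneg: "0 \<le> p u" and Nil: "p [] = 1"
    and extend: "p (u @ [False]) + p (u @ [True]) = p u"
    and stationary: "p (False # u) + p (True # u) = p u"
begin

lemma sum_words_Suc: "(\<Sum>u\<in>words (Suc n). F u) = (\<Sum>u\<in>words n. F (False # u) + F (True # u))"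
  for F :: "bool list \<Rightarrow> real"
  unfolding words_Suc by (subst sum.union_disjoint) (auto simp: sum.reindex sum.distrib)

lemma sum_suffix: "(\<Sum>v\<in>words n. p (u @ v)) = p u"
proof (induction n arbitrary: u)
  case (Suc n)
  have "(\<Sum>v\<in>words (Suc n). p (u @ v))
     = (\<Sum>v\<in>words n. p ((u @ [False]) @ v)) + (\<Sum>v\<in>words n. p ((u @ [True]) @ v))"
    by (simp add: sum_words_Suc sum.distrib)
  then show ?case unfolding Suc.IH by (simp add: extend)
qed (simp add: words_0)

lemma sum_prefix: "(\<Sum>u\<in>words m. p (u @ v)) = p v"
  by (induction m) (simp_all add: words_0 sum_words_Suc stationary)

lemma sum_words: "(\<Sum>u\<in>words n. p u) = 1"
  using sum_suffix[where n=n and u="[]"] by (simp add: Nil)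

lemma sum_words_append:
  "(\<Sum>u\<in>words (m + n). F u) = (\<Sum>u\<in>words m. \<Sum>v\<in>words n. F (u @ v))"
  for F :: "bool list \<Rightarrow> real"
  by (induction m arbitrary: F) (simp_all add: words_0 sum_words_Suc sum.distrib)

lemma le_1: "p u \<le> 1"
  using member_le_sum[of u "words (length u)" p] sum_words[of "length u"] nonneg
  by simp

lemma entropy_nonneg: "0 \<le> word_entropy p n"
  unfolding word_entropy_def
proof (intro sum_nonneg)
  show "0 \<le> - (p u * ln (p u))" for u
  proof (cases "p u = 0")
    case False
    then have "0 < p u" using nonneg[of u] by simp
    then have "ln (p u) \<le> 0" using le_1[of u] by simp
    then show ?thesis using nonneg[of u] by (simp add: mult_nonneg_nonpos)
  qed simp
qed

text \<open>Gibbs' inequality against the law \<open>q\<close> under which the first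
  \<open>m\<close> and the last \<open>n\<close> letters are independent. The logarithm splits the
  cross entropy in two; \<open>sum_suffix\<close> reduces one part to words of length
  \<open>m\<close>, and \<open>sum_prefix\<close>, which rests on \<open>stationary\<close>, reduces
  the other to words of length \<open>n\<close>.\<close>

lemma entropy_subadditive: "word_entropy p (m + n) \<le> word_entropy p m + word_entropy p n"
proof -
  define q where "q = (\<lambda>u. p (take m u) * p (drop m u))"
  have q_app: "q (u @ v) = p u * p v" if "u \<in> words m" for u v
    using that by (simp add: q_def words_def)
  have pos: "0 < p u \<and> 0 < p v" if "0 < p (u @ v)" for u v
  proof -
    have "p (u @ v) \<le> (\<Sum>v\<in>words (length v). p (u @ v))"
      by (rule member_le_sum) (auto simp: nonneg)
    moreover have "p (u @ v) \<le> (\<Sum>u\<in>words (length u). p (u @ v))"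
      by (rule member_le_sum[where f="\<lambda>u. p (u @ v)"]) (auto simp: nonneg)
    ultimately show ?thesis using that unfolding sum_suffix sum_prefix by linarith
  qed
  have "(\<Sum>u\<in>words (m + n). - (p u * ln (p u))) \<le> (\<Sum>u\<in>words (m + n). - (p u * ln (q u)))"
  proof (rule gibbs)
    show "0 < q s" if "0 < p s" for s
      using pos[of "take m s" "drop m s"] that by (simp add: q_def)
    have "(\<Sum>u\<in>words (m + n). q u) = (\<Sum>u\<in>words m. \<Sum>v\<in>words n. p u * p v)"
      unfolding sum_words_append by (intro sum.cong refl q_app)
    also have "\<dots> = 1" by (simp add: sum_distrib_left[symmetric] sum_words)
    finally show "sum q (words (m + n)) \<le> sum p (words (m + n))" by (simp add: sum_words)
  qed (simp_all add: q_def nonneg)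
  also have "\<dots> = (\<Sum>u\<in>words m. \<Sum>v\<in>words n. - (p (u @ v) * ln (p u)) - p (u @ v) * ln (p v))"
    unfolding sum_words_append
  proof (intro sum.cong refl)
    fix u v assume u: "u \<in> words m"
    show "- (p (u @ v) * ln (q (u @ v))) = - (p (u @ v) * ln (p u)) - p (u @ v) * ln (p v)"
    proof (cases "p (u @ v) = 0")
      case False
      then have "0 < p (u @ v)" using nonneg[of "u @ v"] by simp
      from pos[OF this] show ?thesis unfolding q_app[OF u] by (simp add: ln_mult algebra_simps)
    qed simp
  qed
  also have "\<dots> = (\<Sum>u\<in>words m. \<Sum>v\<in>words n. - (p (u @ v) * ln (p u)))
      + (\<Sum>v\<in>words n. \<Sum>u\<in>words m. - (p (u @ v) * ln (p v)))"
    by (subst (2) sum.swap) (simp add: sum_subtractf sum_negf)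
  also have "\<dots> = word_entropy p m + word_entropy p n"
    by (simp add: word_entropy_def sum_negf sum_distrib_right[symmetric] sum_suffix sum_prefix)
  finally show ?thesis by (simp add: word_entropy_def)
qed

lemma entropy_0: "word_entropy p 0 = 0"
  by (simp add: word_entropy_def words_0 Nil)

end

text \<open>Fekete's subadditive lemma. The limit is the infimum \<open>L\<close>: once
  \<open>H m / m\<close> is close to \<open>L\<close>, dividing \<open>n\<close> by \<open>m\<close>
  with remainder carries this over to all large \<open>n\<close>.\<close>

lemma fekete:
  fixes H :: "nat \<Rightarrow> real"
  assumes nonneg: "\<And>n. 0 \<le> H n" and H0: "H 0 = 0"
    and sub: "\<And>m n. H (m + n) \<le> H m + H n"
  shows "convergent (\<lambda>n. H n / real n)"
proof -
  have mult: "H (q * m) \<le> real q * H m" for q m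
  proof (induction q)
    case (Suc q)
    then show ?case using sub[of m "q * m"] by (simp add: algebra_simps)
  qed (simp add: H0)
  define L where "L = (INF n\<in>{1..}. H n / real n)"
  have bdd: "bdd_below ((\<lambda>n. H n / real n) ` {1..})"
    by (rule bdd_belowI[of _ 0]) (auto simp: nonneg)
  have lower: "L \<le> H n / real n" if "n \<ge> 1" for n
    unfolding L_def using that by (intro cINF_lower[OF bdd]) auto
  have "(\<lambda>n. H n / real n) \<longlonglongrightarrow> L"
  proof (rule LIMSEQ_I)
    fix e :: real assume e: "e > 0"
    have "\<exists>m\<in>{1..}. H m / real m < L + e / 2"
      using e cINF_less_iff[OF _ bdd, of "L + e/2"] by (auto simp: L_def)
    then obtain m where m: "m \<ge> 1" "H m / real m < L + e / 2" by auto
    \<comment> \<open>Bounds the contribution of the remainder, since \<open>H (n mod m)\<close> is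
      at most \<open>(n mod m) * H 1\<close>.\<close>
    define C where "C = real m * H 1"
    obtain n0 where n0: "real n0 > 2 * C / e" using reals_Archimedean2 by blast
    have "norm (H n / real n - L) < e" if n: "n \<ge> max 1 n0" for n
    proof -
      have n1: "real n > 0" using n by simp
      \<comment> \<open>The factor 1 puts the remainder into the form to which \<open>mult\<close>
        applies, with block length 1.\<close>
      have "H n \<le> H (n div m * m) + H (n mod m * 1)"
        using sub[of "n div m * m" "n mod m"] by simp
      also have "\<dots> \<le> real (n div m) * H m + real (n mod m) * H 1"
        by (intro add_mono mult)
      also have "\<dots> \<le> real n / real m * H m + real m * H 1"
        using m nonneg of_nat_div_le_of_nat[of n m, where ?'a=real] mod_less_divisor[of m n]
        by (intro add_mono mult_right_mono) auto
      finally have "H n / real n \<le> (real n / real m * H m + C) / real n"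
        using n1 by (simp add: C_def divide_right_mono)
      also have "\<dots> = H m / real m + C / real n" using n1 m by (simp add: field_simps)
      finally have "H n / real n \<le> H m / real m + C / real n" .
      moreover have "C / real n < e / 2"
      proof -
        have "2 * C / e < real n" using n n0 by linarith
        then show ?thesis using e n1 by (simp add: field_simps)
      qed
      moreover have "L \<le> H n / real n" using lower n by simp
      ultimately show ?thesis unfolding real_norm_def using m(2) by linarith
    qed
    then show "\<exists>no. \<forall>n\<ge>no. norm (H n / real n - L) < e" by blast
  qed
  then show ?thesis by (auto simp: convergent_def)
qed

lemma (in stationary_law) entropy_rate_convergent:
  "convergent (\<lambda>n. word_entropy p n / real n)"
  by (intro fekete entropy_nonneg entropy_0 entropy_subadditive)

subsection \<open>Generated measures\<close>

text \<open>The delicate case is \<open>l = 0\<close>, where \<open>ln\<close> diverges but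
  \<open>x * ln x\<close> still tends to 0, which is its value at 0.\<close>

lemma tendsto_mult_ln_self:
  fixes f :: "nat \<Rightarrow> real"
  assumes f: "f \<longlonglongrightarrow> l" and nonneg: "\<And>n. 0 \<le> f n"
  shows "(\<lambda>n. f n * ln (f n)) \<longlonglongrightarrow> l * ln l"
proof (cases "l = 0")
  case True
  have bound: "\<bar>x * ln x\<bar> \<le> 2 * sqrt x" if "0 \<le> x" "x < 1" for x :: real
  proof (cases "x = 0")
    case False
    with that have x: "0 < x" by simp
    \<comment> \<open>Taking the square root first leaves a factor \<open>sqrt x\<close> to spare:
      \<open>- ln x\<close> is at most \<open>2 / sqrt x\<close>.\<close>
    have "ln (1 / sqrt x) \<le> 1 / sqrt x - 1" using x by (intro ln_le_minus_one) simp
    then have "- ln x \<le> 2 / sqrt x" using x by (simp add: ln_div ln_sqrt)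
    then have "x * - ln x \<le> x * (2 / sqrt x)" using x by (intro mult_left_mono) auto
    also have "\<dots> = 2 * sqrt x" using x by (simp add: field_simps)
    finally show ?thesis using x that by (simp add: abs_mult)
  qed simp
  have "(\<lambda>n. 2 * sqrt (f n)) \<longlonglongrightarrow> 2 * sqrt 0"
    by (intro tendsto_intros) (use f True in simp)
  then have lim: "(\<lambda>n. 2 * sqrt (f n)) \<longlonglongrightarrow> 0" by simp
  have "eventually (\<lambda>n. f n < 1) sequentially"
    using order_tendstoD(2)[OF f, of 1] True by simp
  then have ev: "eventually (\<lambda>n. norm (f n * ln (f n)) \<le> 2 * sqrt (f n)) sequentially"
    by eventually_elim (use bound nonneg in simp)
  have "(\<lambda>n. f n * ln (f n)) \<longlonglongrightarrow> 0"
    by (rule Lim_null_comparison[OF ev lim])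
  then show ?thesis using True by simp
qed (auto intro!: tendsto_intros f)

lemma tendsto_word_entropy:
  assumes "\<And>u. u \<in> words n \<Longrightarrow> (\<lambda>k. p k u) \<longlonglongrightarrow> q u" "\<And>k u. 0 \<le> p k u"
  shows "(\<lambda>k. word_entropy (p k) n) \<longlonglongrightarrow> word_entropy q n"
  unfolding word_entropy_def
  by (intro tendsto_sum tendsto_minus tendsto_mult_ln_self assms)

section \<open>Averages along orbits, and itineraries with respect to a set and its
  complement\<close>

definition avg :: "('a \<Rightarrow> 'a) \<Rightarrow> 'a \<Rightarrow> ('a \<Rightarrow> real) \<Rightarrow> nat \<Rightarrow> real" where
  "avg T z g n = (\<Sum>i<n. g ((T ^^ i) z)) / real n"

lemma avg_mono: "(\<And>x. g x \<le> g' x) \<Longrightarrow> avg T z g n \<le> avg T z g' n"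
  by (simp add: avg_def divide_right_mono sum_mono)

lemma avg_comp: "avg T z (\<lambda>x. g (T x)) n = avg T z g n + (g ((T ^^ n) z) - g z) / real n"
proof -
  have "(\<Sum>i<n. g (T ((T ^^ i) z))) = (\<Sum>i<n. g ((T ^^ i) z)) + (g ((T ^^ n) z) - g z)"
    by (induction n) simp_all
  then show ?thesis by (simp add: avg_def add_divide_distrib)
qed

definition cell :: "('a \<Rightarrow> 'a) \<Rightarrow> 'a set \<Rightarrow> bool list \<Rightarrow> 'a set" where
  "cell T P u = {x. \<forall>i<length u. ((T ^^ i) x \<in> P) = u ! i}"

definition block :: "('a \<Rightarrow> 'a) \<Rightarrow> 'a set \<Rightarrow> 'a \<Rightarrow> nat \<Rightarrow> nat \<Rightarrow> bool list" where
  "block T P z n t = map (\<lambda>i. (T ^^ (t + i)) z \<in> P) [0..<n]"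

lemma length_block [simp]: "length (block T P z n t) = n"
  by (simp add: block_def)

lemma nth_block [simp]: "i < n \<Longrightarrow> block T P z n t ! i = ((T ^^ (t + i)) z \<in> P)"
  by (simp add: block_def)

lemma in_cell_iff_block:
  assumes "length u = n"
  shows "(T ^^ t) z \<in> cell T P u \<longleftrightarrow> block T P z n t = u"
proof -
  have "(T ^^ i) ((T ^^ t) z) = (T ^^ (t + i)) z" for i
    by (simp add: funpow_add add.commute[of t i])
  then show ?thesis using assms by (auto simp: cell_def list_eq_iff_nth_eq)
qed

text \<open>The link between weak convergence and counting: the empirical measure of a cell is the
  frequency of its word in the itinerary.\<close>

lemma avg_cell:
  assumes "length u = m"
  shows "avg T z (indicator (cell T P u)) n = freq {..<n} (block T P z m) u"
proof -
  have "(\<Sum>i<n. indicator (cell T P u) ((T ^^ i) z)) = real (card {t \<in> {..<n}. block T P z m t = u})"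
    by (simp add: indicator_def in_cell_iff_block[OF assms] sum.If_cases Int_def)
  then show ?thesis by (simp add: avg_def freq_def)
qed

lemma cell_Nil: "cell T P [] = UNIV"
  by (simp add: cell_def)

lemma cell_Cons: "cell T P (b # u) = {x. (x \<in> P) = b} \<inter> T -` cell T P u"
  by (auto simp: cell_def All_less_Suc2 funpow_swap1)

lemma cell_snoc: "cell T P (u @ [b]) = {x \<in> cell T P u. ((T ^^ length u) x \<in> P) = b}"
  by (auto simp: cell_def All_less_Suc nth_append)

text \<open>Test functions are continuous on the whole type and bounded by 1, and
  \<open>\<mu>\<close> may be concentrated on a subset. This covers both \<open>f\<close> on a
  compact type and the shift on the non-compact type \<open>int \<Rightarrow> real\<close>.\<close>

locale generated = prob_space \<mu> for \<mu> :: "'a::metric_space measure" +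
  fixes T :: "'a \<Rightarrow> 'a" and z :: 'a and r :: "nat \<Rightarrow> nat"
  assumes sets_eq [measurable_cong]: "sets \<mu> = sets borel"
    and cont_T: "continuous_on UNIV T"
    and strict_mono_r: "strict_mono r"
    and averages: "\<And>g. continuous_on UNIV g \<Longrightarrow> (\<And>x. \<bar>g x\<bar> \<le> 1)
          \<Longrightarrow> (\<lambda>k. avg T z g (r k)) \<longlonglongrightarrow> (\<integral>x. g x \<partial>\<mu>)"
begin

lemma space_eq [simp]: "space \<mu> = UNIV"
  using sets_eq_imp_space_eq[OF sets_eq] by simp

lemma T_measurable [measurable]: "T \<in> borel_measurable borel"
  using cont_T by (rule borel_measurable_continuous_onI)

lemma inverse_r_tendsto: "(\<lambda>k. inverse (real (r k))) \<longlonglongrightarrow> 0"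
  using LIMSEQ_subseq_LIMSEQ[OF lim_inverse_n strict_mono_r] by (simp add: o_def)

lemma integrable_bounded [intro]:
  fixes g :: "'a \<Rightarrow> real"
  assumes [measurable]: "g \<in> borel_measurable borel" and "\<And>x. \<bar>g x\<bar> \<le> 1"
  shows "integrable \<mu> g"
  using assms(2) by (intro integrable_const_bound[where B=1]) auto

text \<open>Composing with \<open>T\<close> changes an orbit average only by the boundary term of
  \<open>avg_comp\<close>, which is at most \<open>2 / r k\<close>.\<close>

lemma integral_comp_continuous:
  fixes g :: "'a \<Rightarrow> real"
  assumes g: "continuous_on UNIV g" and b: "\<And>x. \<bar>g x\<bar> \<le> 1"
  shows "(\<integral>x. g (T x) \<partial>\<mu>) = (\<integral>x. g x \<partial>\<mu>)"
proof -
  have "(\<lambda>k. (g ((T ^^ r k) z) - g z) / real (r k)) \<longlonglongrightarrow> 0"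
  proof (rule Lim_null_comparison)
    show "eventually (\<lambda>k. norm ((g ((T ^^ r k) z) - g z) / real (r k)) \<le> 2 * inverse (real (r k))) sequentially"
    proof (intro always_eventually allI)
      fix k
      have "\<bar>g ((T ^^ r k) z) - g z\<bar> \<le> 2" using b[of "(T ^^ r k) z"] b[of z] by linarith
      then show "norm ((g ((T ^^ r k) z) - g z) / real (r k)) \<le> 2 * inverse (real (r k))"
        by (simp add: abs_mult divide_inverse mult_right_mono)
    qed
    show "(\<lambda>k. 2 * inverse (real (r k))) \<longlonglongrightarrow> 0"
      using tendsto_mult_right_zero[OF inverse_r_tendsto] by simp
  qed
  from tendsto_add[OF averages[OF g b] this]
  have "(\<lambda>k. avg T z (\<lambda>x. g (T x)) (r k)) \<longlonglongrightarrow> (\<integral>x. g x \<partial>\<mu>)"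
    by (simp add: avg_comp)
  moreover have "(\<lambda>k. avg T z (\<lambda>x. g (T x)) (r k)) \<longlonglongrightarrow> (\<integral>x. g (T x) \<partial>\<mu>)"
    using continuous_on_compose2[OF g cont_T] b by (intro averages) auto
  ultimately show ?thesis by (rule LIMSEQ_unique[rotated])
qed

text \<open>Functions that are Riemann integrable with respect to \<open>\<mu>\<close>: for these, weak convergence
  and the invariance of the integrals of continuous functions carry over.\<close>

definition sandwich :: "('a \<Rightarrow> real) \<Rightarrow> real \<Rightarrow> ('a \<Rightarrow> real) \<Rightarrow> ('a \<Rightarrow> real) \<Rightarrow> bool" where
  "sandwich g e l u \<longleftrightarrow> continuous_on UNIV l \<and> continuous_on UNIV u \<and>
     (\<forall>x. 0 \<le> l x \<and> l x \<le> g x \<and> g x \<le> u x \<and> u x \<le> 1) \<and> (\<integral>x. u x - l x \<partial>\<mu>) < e"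

definition squeezed :: "('a \<Rightarrow> real) \<Rightarrow> bool" where
  "squeezed g \<longleftrightarrow> g \<in> borel_measurable borel \<and> (\<forall>e>0. \<exists>l u. sandwich g e l u)"

lemma sandwichD:
  assumes "sandwich g e l u"
  shows "continuous_on UNIV l" "continuous_on UNIV u"
    "0 \<le> l x" "l x \<le> g x" "g x \<le> u x" "u x \<le> 1"
    "(\<integral>x. u x - l x \<partial>\<mu>) < e" "integrable \<mu> l" "integrable \<mu> u"
    "\<bar>l x\<bar> \<le> 1" "\<bar>u x\<bar> \<le> 1"
proof -
  have b: "0 \<le> l x" "l x \<le> g x" "g x \<le> u x" "u x \<le> 1" for x
    using assms by (auto simp: sandwich_def)
  have b1: "\<bar>l x\<bar> \<le> 1" "\<bar>u x\<bar> \<le> 1" for x using b[of x] by linarith+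
  show c: "continuous_on UNIV l" "continuous_on UNIV u" "(\<integral>x. u x - l x \<partial>\<mu>) < e"
    using assms by (auto simp: sandwich_def)
  show "integrable \<mu> l" "integrable \<mu> u"
    using c(1,2) b1 by (auto intro!: integrable_bounded borel_measurable_continuous_onI)
  show "0 \<le> l x" "l x \<le> g x" "g x \<le> u x" "u x \<le> 1" "\<bar>l x\<bar> \<le> 1" "\<bar>u x\<bar> \<le> 1"
    by (rule b b1)+
qed

lemma squeezedE:
  assumes "squeezed g" "e > 0"
  obtains l u where "sandwich g e l u"
  using assms unfolding squeezed_def by blast

lemma squeezed_integrable:
  assumes "squeezed g"
  shows "integrable \<mu> g"
proof -
  obtain l u where "sandwich g 1 l u" using squeezedE[OF assms zero_less_one] by blast
  note lu = sandwichD(3-6)[OF this]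
  have "\<bar>g x\<bar> \<le> 1" for x using lu(1)[of x] lu(2)[of x] lu(3)[of x] lu(4)[of x] by linarith
  then show ?thesis using assms by (auto simp: squeezed_def)
qed

text \<open>The averages of \<open>g\<close> are trapped between those of \<open>l\<close> and
  \<open>u\<close>, whose limits lie less than \<open>e / 2\<close> apart with the integral of
  \<open>g\<close> in between.\<close>

lemma squeezed_averages:
  assumes g: "squeezed g"
  shows "(\<lambda>k. avg T z g (r k)) \<longlonglongrightarrow> (\<integral>x. g x \<partial>\<mu>)"
proof (rule tendstoI)
  fix e :: real assume e: "e > 0"
  then have "e / 2 > 0" by simp
  from squeezedE[OF g this] obtain l u where "sandwich g (e / 2) l u" by blast
  note lu = sandwichD[OF this]
  have "(\<integral>x. l x \<partial>\<mu>) \<le> (\<integral>x. g x \<partial>\<mu>)" "(\<integral>x. g x \<partial>\<mu>) \<le> (\<integral>x. u x \<partial>\<mu>)"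
    using lu squeezed_integrable[OF g] by (auto intro: integral_mono)
  moreover have "(\<integral>x. u x \<partial>\<mu>) - (\<integral>x. l x \<partial>\<mu>) < e / 2"
    using lu by simp
  moreover have "eventually (\<lambda>k. dist (avg T z l (r k)) (\<integral>x. l x \<partial>\<mu>) < e / 2) sequentially"
    "eventually (\<lambda>k. dist (avg T z u (r k)) (\<integral>x. u x \<partial>\<mu>) < e / 2) sequentially"
    by (rule tendstoD[OF averages[OF lu(1,10)] \<open>e / 2 > 0\<close>], rule tendstoD[OF averages[OF lu(2,11)] \<open>e / 2 > 0\<close>])
  then show "eventually (\<lambda>k. dist (avg T z g (r k)) (\<integral>x. g x \<partial>\<mu>) < e) sequentially"
  proof eventually_elim
    case (elim k)
    then show ?case
      using calculation avg_mono[of l g T z "r k", OF lu(4)] avg_mono[of g u T z "r k", OF lu(5)]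
      unfolding dist_real_def by linarith
  qed
qed

lemma squeezed_one: "squeezed (\<lambda>_. 1)"
  unfolding squeezed_def
proof (intro conjI allI impI)
  show "\<exists>l u. sandwich (\<lambda>_. 1) e l u"
    if "e > 0" for e :: real
    using that unfolding sandwich_def by (intro exI[of _ "\<lambda>_. 1"]) auto
qed simp

lemma squeezed_compl:
  assumes "squeezed g"
  shows "squeezed (\<lambda>x. 1 - g x)"
  unfolding squeezed_def
proof (intro conjI allI impI)
  show "(\<lambda>x. 1 - g x) \<in> borel_measurable borel" using assms by (auto simp: squeezed_def)
  fix e :: real assume "e > 0"
  from squeezedE[OF assms this] obtain l u where "sandwich g e l u" by blast
  note lu = sandwichD[OF this]
  show "\<exists>l u. sandwich (\<lambda>x. 1 - g x) e l u"
    using lu unfolding sandwich_def by (intro exI[of _ "\<lambda>x. 1 - u x"] exI[of _ "\<lambda>x. 1 - l x"])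
      (auto intro!: continuous_intros)
qed

lemma squeezed_mult:
  assumes "squeezed g" "squeezed g'"
  shows "squeezed (\<lambda>x. g x * g' x)"
  unfolding squeezed_def
proof (intro conjI allI impI)
  show "(\<lambda>x. g x * g' x) \<in> borel_measurable borel" using assms by (auto simp: squeezed_def)
  fix e :: real assume "e > 0"
  then have e: "e / 2 > 0" by simp
  from squeezedE[OF assms(1) e] obtain l u where "sandwich g (e / 2) l u" by blast
  note lu = sandwichD[OF this]
  from squeezedE[OF assms(2) e] obtain l' u' where "sandwich g' (e / 2) l' u'" by blast
  note lu' = sandwichD[OF this]
  have nn: "0 \<le> g x" "0 \<le> u x" "0 \<le> g' x" "0 \<le> u' x" "l x \<le> u x" "l' x \<le> u' x" "l x \<le> 1" for x
    using lu(3-6)[of x] lu'(3-6)[of x] by linarith+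
  have cont: "continuous_on UNIV (\<lambda>x. l x * l' x)" "continuous_on UNIV (\<lambda>x. u x * u' x)"
    using lu(1,2) lu'(1,2) by (auto intro!: continuous_intros)
  have bnd: "0 \<le> l x * l' x" "l x * l' x \<le> g x * g' x" "g x * g' x \<le> u x * u' x" "u x * u' x \<le> 1" for x
    using lu(3-6)[of x] lu'(3-6)[of x] nn[of x] by (auto intro: mult_mono mult_le_one)
  \<comment> \<open>Splits \<open>u u' - l l'\<close> as \<open>(u - l) u' + l (u' - l')\<close>,
    where \<open>u' \<le> 1\<close> and \<open>l \<le> 1\<close>.\<close>
  have le: "u x * u' x - l x * l' x \<le> (u x - l x) + (u' x - l' x)" for x
  proof -
    have "(u x - l x) * u' x \<le> (u x - l x) * 1" "l x * (u' x - l' x) \<le> 1 * (u' x - l' x)"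
      using mult_left_mono[OF lu'(6)[of x], of "u x - l x"]
        mult_right_mono[of "l x" 1 "u' x - l' x"] nn[of x] by auto
    then show ?thesis by (simp add: algebra_simps)
  qed
  have "(\<integral>x. u x * u' x - l x * l' x \<partial>\<mu>) \<le> (\<integral>x. (u x - l x) + (u' x - l' x) \<partial>\<mu>)"
  proof (intro integral_mono le)
    show "integrable \<mu> (\<lambda>x. u x * u' x - l x * l' x)"
    proof (rule integrable_bounded)
      show "(\<lambda>x. u x * u' x - l x * l' x) \<in> borel_measurable borel"
        using cont by (intro borel_measurable_continuous_onI continuous_on_diff)
      show "\<bar>u x * u' x - l x * l' x\<bar> \<le> 1" for x
        using bnd[of x] by linarith
    qed
  qed (use lu lu' in auto)
  also have "\<dots> < e" using lu lu' by simp
  finally show "\<exists>l u. sandwich (\<lambda>x. g x * g' x) e l u"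
    using cont bnd unfolding sandwich_def by blast
qed

lemma squeezed_comp:
  assumes "squeezed g"
  shows "squeezed (\<lambda>x. g (T x))"
  unfolding squeezed_def
proof (intro conjI allI impI)
  show "(\<lambda>x. g (T x)) \<in> borel_measurable borel"
    using assms measurable_compose[OF T_measurable, of g borel] by (simp add: squeezed_def)
  fix e :: real assume "e > 0"
  from squeezedE[OF assms this] obtain l u where "sandwich g e l u" by blast
  note lu = sandwichD[OF this]
  have "\<bar>u x - l x\<bar> \<le> 1" for x
    using lu(3)[of x] lu(4)[of x] lu(5)[of x] lu(6)[of x] by linarith
  then have "(\<integral>x. u (T x) - l (T x) \<partial>\<mu>) = (\<integral>x. u x - l x \<partial>\<mu>)"
    using lu(1,2) by (intro integral_comp_continuous[where g="\<lambda>x. u x - l x"] continuous_intros) auto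
  then show "\<exists>l u. sandwich (\<lambda>x. g (T x)) e l u"
    using lu continuous_on_compose2[OF lu(1) cont_T] continuous_on_compose2[OF lu(2) cont_T]
    unfolding sandwich_def by (intro exI[of _ "\<lambda>x. l (T x)"] exI[of _ "\<lambda>x. u (T x)"]) auto
qed

text \<open>The integrals of \<open>l\<close> and \<open>u\<close> do not change under
  \<open>T\<close>, so the integrals of \<open>g\<close> and \<open>g \<circ> T\<close> lie in one
  interval, which can be made shorter than their supposed distance \<open>d\<close>.\<close>

lemma squeezed_integral_comp:
  assumes g: "squeezed g"
  shows "(\<integral>x. g (T x) \<partial>\<mu>) = (\<integral>x. g x \<partial>\<mu>)"
proof (rule ccontr)
  define d where "d = \<bar>(\<integral>x. g (T x) \<partial>\<mu>) - (\<integral>x. g x \<partial>\<mu>)\<bar>"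
  assume "\<not> ?thesis"
  then have "0 < d" by (simp add: d_def)
  from squeezedE[OF g this] obtain l u where "sandwich g d l u" by blast
  note lu = sandwichD[OF this]
  have int: "integrable \<mu> (\<lambda>x. l (T x))" "integrable \<mu> (\<lambda>x. u (T x))"
    using continuous_on_compose2[OF lu(1) cont_T] continuous_on_compose2[OF lu(2) cont_T] lu(10,11)
    by (auto intro!: integrable_bounded borel_measurable_continuous_onI)
  have "(\<integral>x. l x \<partial>\<mu>) \<le> (\<integral>x. g x \<partial>\<mu>)" "(\<integral>x. g x \<partial>\<mu>) \<le> (\<integral>x. u x \<partial>\<mu>)"
    using lu squeezed_integrable[OF g] by (auto intro: integral_mono)
  moreover have "(\<integral>x. l (T x) \<partial>\<mu>) \<le> (\<integral>x. g (T x) \<partial>\<mu>)" "(\<integral>x. g (T x) \<partial>\<mu>) \<le> (\<integral>x. u (T x) \<partial>\<mu>)"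
    using int lu(4,5) squeezed_integrable[OF squeezed_comp[OF g]] by (auto intro: integral_mono)
  moreover have "(\<integral>x. u x \<partial>\<mu>) - (\<integral>x. l x \<partial>\<mu>) < d"
    using lu by simp
  ultimately show False
    using integral_comp_continuous[OF lu(1,10)] integral_comp_continuous[OF lu(2,11)] unfolding d_def by linarith
qed

text \<open>The indicator can jump only on the null set where \<open>h = c\<close>. The
  neighbourhoods \<open>A n\<close> decrease to that set, so their measures tend to 0, and two ramps
  that differ only on \<open>A n\<close> enclose the indicator.\<close>

lemma squeezed_superlevel:
  fixes h :: "'a \<Rightarrow> real"
  assumes h: "continuous_on UNIV h" and null: "measure \<mu> {x. h x = c} = 0"
  shows "squeezed (indicator {x. h x > c})"
  unfolding squeezed_def
proof (intro conjI allI impI)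
  have [measurable]: "h \<in> borel_measurable borel"
    using h by (rule borel_measurable_continuous_onI)
  show "indicat_real {x. h x > c} \<in> borel_measurable borel"
    by (intro borel_measurable_indicator borel_open open_Collect_less continuous_on_const h)
  fix e :: real assume e: "e > 0"
  define A where "A = (\<lambda>n. {x. \<bar>h x - c\<bar> \<le> inverse (real (Suc n))})"
  have "(\<lambda>n. measure \<mu> (A n)) \<longlonglongrightarrow> measure \<mu> (\<Inter>n. A n)"
  proof (intro finite_Lim_measure_decseq)
    show "range A \<subseteq> sets \<mu>" unfolding A_def sets_eq by auto
    have "inverse (real (Suc n)) \<le> inverse (real (Suc m))" if "m \<le> n" for m n
      using that by (intro le_imp_inverse_le) auto
    then show "decseq A" unfolding decseq_def A_def by (auto intro: order_trans)
  qed
  also have "(\<Inter>n. A n) = {x. h x = c}"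
  proof (intro equalityI subsetI)
    fix x assume x: "x \<in> (\<Inter>n. A n)"
    have "\<bar>h x - c\<bar> \<le> 0"
      by (rule LIMSEQ_le_const[OF LIMSEQ_inverse_real_of_nat]) (use x in \<open>auto simp: A_def\<close>)
    then show "x \<in> {x. h x = c}" by simp
  qed (auto simp: A_def)
  finally have "eventually (\<lambda>n. measure \<mu> (A n) < e) sequentially"
    using null e by (intro order_tendstoD(2)) auto
  then obtain n where n: "measure \<mu> (A n) < e" by (auto simp: eventually_sequentially)
  define w where "w = real (Suc n)"
  have w: "w > 0" by (simp add: w_def)
  \<comment> \<open>Both ramps have slope \<open>w\<close> as functions of \<open>h\<close>:
    \<open>l\<close> rises from 0 to 1 as \<open>h\<close> goes from \<open>c\<close> to
    \<open>c + 1 / w\<close>, and \<open>u\<close> as \<open>h\<close> goes from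
    \<open>c - 1 / w\<close> to \<open>c\<close>.\<close>
  define l where "l = (\<lambda>x. min 1 (max 0 (w * (h x - c))))"
  define u where "u = (\<lambda>x. min 1 (max 0 (1 + w * (h x - c))))"
  have cont: "continuous_on UNIV l" "continuous_on UNIV u"
    using h by (auto simp: l_def u_def intro!: continuous_intros)
  have bnd: "0 \<le> l x" "l x \<le> indicator {x. h x > c} x" "indicator {x. h x > c} x \<le> u x" "u x \<le> 1" for x
    using w mult_pos_pos[of w "h x - c"] mult_nonneg_nonpos[of w "h x - c"]
    by (auto simp: l_def u_def indicator_def)
  have le: "u x - l x \<le> indicator (A n) x" for x
  proof (cases "x \<in> A n")
    case False
    then have "inverse w < \<bar>h x - c\<bar>" by (auto simp: A_def w_def)
    then have "1 < w * \<bar>h x - c\<bar>"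
      using w by (simp add: field_simps)
    then have "1 < \<bar>w * (h x - c)\<bar>"
      using w by (simp only: abs_mult abs_of_pos)
    then show ?thesis by (auto simp: l_def u_def indicator_def)
  qed (use bnd[of x] in simp)
  have An: "A n \<in> sets borel" unfolding A_def by simp
  have "(\<integral>x. u x - l x \<partial>\<mu>) \<le> (\<integral>x. indicator (A n) x \<partial>\<mu>)"
  proof (intro integral_mono le)
    show "integrable \<mu> (\<lambda>x. u x - l x)"
    proof (rule integrable_bounded)
      show "(\<lambda>x. u x - l x) \<in> borel_measurable borel"
        using cont by (intro borel_measurable_continuous_onI continuous_on_diff)
      show "\<bar>u x - l x\<bar> \<le> 1" for x
        using bnd[of x] by linarith
    qed
    show "integrable \<mu> (indicat_real (A n))" using An by (intro integrable_bounded) auto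
  qed
  also have "\<dots> < e" using n An by (simp add: sets_eq)
  finally show "\<exists>l u. sandwich (indicator {x. h x > c}) e l u"
    using cont bnd unfolding sandwich_def by blast
qed

section \<open>Cells of a set with squeezed indicator\<close>

context
  fixes P :: "'a set"
  assumes P: "squeezed (indicator P)"
begin

lemma squeezed_cell: "squeezed (indicator (cell T P u))"
proof (induction u)
  case Nil
  then show ?case using squeezed_one by (simp add: cell_Nil indicator_def)
next
  case (Cons b u)
  have "squeezed (\<lambda>x. (if b then indicator P x else 1 - indicator P x) * indicator (cell T P u) (T x))"
    using squeezed_mult[OF _ squeezed_comp[OF Cons]] P squeezed_compl[OF P] by (cases b) auto
  also have "(\<lambda>x. (if b then indicator P x else 1 - indicator P x) * indicator (cell T P u) (T x))
      = indicat_real (cell T P (b # u))"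
    by (auto simp: cell_Cons indicator_def fun_eq_iff)
  finally show ?case .
qed

lemma cell_sets [measurable]: "cell T P u \<in> sets borel"
  using squeezed_cell[of u] by (simp add: squeezed_def borel_measurable_indicator_iff)

text \<open>Consistency is additivity of the measure. Stationarity is
  \<open>squeezed_integral_comp\<close> applied to the indicator of a cell, since prepending a free
  letter gives the preimage of the cell under \<open>T\<close>.\<close>

lemma stationary_law_cell: "stationary_law (\<lambda>u. measure \<mu> (cell T P u))"
proof
  fix u
  show "0 \<le> measure \<mu> (cell T P u)" by simp
  show "measure \<mu> (cell T P []) = 1" using prob_space by (simp add: cell_Nil)
  have eq: "cell T P (u @ [False]) \<union> cell T P (u @ [True]) = cell T P u"
    by (auto simp: cell_snoc)
  have disj: "cell T P (u @ [False]) \<inter> cell T P (u @ [True]) = {}"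
    by (auto simp: cell_snoc)
  show "measure \<mu> (cell T P (u @ [False])) + measure \<mu> (cell T P (u @ [True])) = measure \<mu> (cell T P u)"
    using finite_measure_Union[OF _ _ disj] by (simp add: eq sets_eq cell_sets)
  have eq': "cell T P (False # u) \<union> cell T P (True # u) = T -` cell T P u"
    by (auto simp: cell_Cons)
  have disj': "cell T P (False # u) \<inter> cell T P (True # u) = {}"
    by (auto simp: cell_Cons)
  have "measure \<mu> (cell T P (False # u)) + measure \<mu> (cell T P (True # u)) = measure \<mu> (T -` cell T P u)"
    using finite_measure_Union[OF _ _ disj'] by (simp add: eq' sets_eq cell_sets)
  also have "\<dots> = (\<integral>x. indicator (cell T P u) (T x) \<partial>\<mu>)"
  proof -
    have "T -` cell T P u \<in> sets borel"
      using measurable_sets[OF T_measurable cell_sets] by simp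
    then show ?thesis by (simp add: indicator_vimage[symmetric] sets_eq)
  qed
  also have "\<dots> = measure \<mu> (cell T P u)"
    by (subst squeezed_integral_comp[OF squeezed_cell]) (simp add: sets_eq)
  finally show "measure \<mu> (cell T P (False # u)) + measure \<mu> (cell T P (True # u)) = measure \<mu> (cell T P u)" .
qed

lemma block_freq_tendsto:
  assumes "length u = n"
  shows "(\<lambda>k. freq {..<r k} (block T P z n) u) \<longlonglongrightarrow> measure \<mu> (cell T P u)"
  using squeezed_averages[OF squeezed_cell, of u] by (simp add: avg_cell[OF assms] sets_eq)

lemma block_entropy_tendsto:
  "(\<lambda>k. word_entropy (freq {..<r k} (block T P z n)) n)
     \<longlonglongrightarrow> word_entropy (\<lambda>u. measure \<mu> (cell T P u)) n"
  by (intro tendsto_word_entropy block_freq_tendsto freq_nonneg) simp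

end

end

subsection \<open>Entropy of two-element partitions\<close>

lemma join_iter_two: "join_iter T {P, - P} n = cell T P ` words n - {{}}"
proof -
  \<comment> \<open>True even if \<open>P\<close> or its complement is empty; hence the letter
    \<open>a i = P\<close> identifies which of the two sets \<open>a i\<close> is.\<close>
  have ne: "P \<noteq> - P" by auto
  have "{(\<Inter>i<n. (T ^^ i) -` a i) | a. \<forall>i<n. a i \<in> {P, - P}} = cell T P ` words n" (is "?L = ?R")
  proof (intro equalityI subsetI)
    fix A assume "A \<in> ?L"
    then obtain a where A: "A = (\<Inter>i<n. (T ^^ i) -` a i)" and a: "\<forall>i<n. a i \<in> {P, - P}"
      by auto
    have "x \<in> a i \<longleftrightarrow> (x \<in> P) = (a i = P)" if "i < n" for x i
      using a that ne by auto
    then have "A = cell T P (map (\<lambda>i. a i = P) [0..<n])"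
      unfolding A by (auto simp: cell_def)
    then show "A \<in> ?R" by (rule image_eqI) simp
  next
    fix A assume "A \<in> ?R"
    then obtain u where u: "length u = n" and A: "A = cell T P u" by auto
    have "A = (\<Inter>i<n. (T ^^ i) -` (if u ! i then P else - P))"
      unfolding A cell_def using u by (auto split: if_splits)
    then show "A \<in> ?L" by (intro CollectI exI[of _ "\<lambda>i. if u ! i then P else - P"]) auto
  qed
  then show ?thesis by (simp only: join_iter_def)
qed

text \<open>Distinct words have disjoint cells, so nonempty cells determine their words; the empty
  cells removed by \<open>join_iter\<close> have measure 0 and contribute nothing.\<close>

lemma part_entropy_join_iter_two:
  "part_entropy \<mu> (join_iter T {P, - P} n) = word_entropy (\<lambda>u. measure \<mu> (cell T P u)) n"
proof -
  let ?H = "\<lambda>A. - (measure \<mu> A * ln (measure \<mu> A))"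
  let ?W = "{u \<in> words n. cell T P u \<noteq> {}}"
  have inj: "inj_on (cell T P) ?W"
    by (rule inj_onI) (auto simp: cell_def set_eq_iff list_eq_iff_nth_eq)
  have "part_entropy \<mu> (join_iter T {P, - P} n) = (\<Sum>A\<in>cell T P ` ?W. ?H A)"
    unfolding part_entropy_def join_iter_two by (intro sum.cong) auto
  also have "\<dots> = (\<Sum>u\<in>?W. ?H (cell T P u))"
    using inj by (simp add: sum.reindex)
  also have "\<dots> = (\<Sum>u\<in>words n. ?H (cell T P u))"
    by (rule sum.mono_neutral_left) (auto simp del: in_words)
  finally show ?thesis by (simp add: word_entropy_def)
qed

context generated
begin

text \<open>\<open>entropy_part\<close> is defined by \<open>lim\<close>, which is informative only
  for a convergent sequence; stationarity and \<open>fekete\<close> supply the convergence.\<close>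

lemma entropy_part_tendsto:
  assumes "squeezed (indicator P)"
  shows "(\<lambda>n. word_entropy (\<lambda>u. measure \<mu> (cell T P u)) n / real n) \<longlonglongrightarrow> entropy_part \<mu> T {P, - P}"
  using stationary_law.entropy_rate_convergent[OF stationary_law_cell[OF assms]]
  unfolding entropy_part_def part_entropy_join_iter_two by (simp add: convergent_LIMSEQ_iff)

lemma entropy_part_le_metric_entropy:
  assumes "squeezed (indicator P)"
  shows "ereal (entropy_part \<mu> T {P, - P}) \<le> metric_entropy \<mu> T"
proof -
  have "P \<in> sets borel"
    using assms by (simp add: squeezed_def borel_measurable_indicator_iff)
  then have "is_fin_partition \<mu> {P, - P}"
    by (auto simp: is_fin_partition_def sets_eq borel_comp)
  then show ?thesis unfolding metric_entropy_def by (intro SUP_upper) simp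
qed

end

section \<open>From \<open>Vgen\<close> to limits along an explicit sequence\<close>

definition averages_to ::
  "('a::metric_space \<Rightarrow> 'a) \<Rightarrow> 'a set \<Rightarrow> 'a \<Rightarrow> (nat \<Rightarrow> nat) \<Rightarrow> 'a measure \<Rightarrow> bool" where
  "averages_to T Z z r \<mu> \<longleftrightarrow>
     (\<forall>g. continuous_on Z g \<longrightarrow> (\<lambda>k. avg T z g (r k)) \<longlonglongrightarrow> (\<integral>x. indicator Z x * g x \<partial>\<mu>))"

text \<open>Brings the sequence \<open>r\<close> into the open, so that different points can be
  averaged along one common sequence.\<close>

lemma Vgen_iff:
  "\<mu> \<in> Vgen T Z z \<longleftrightarrow> prob_on Z \<mu> \<and> (\<exists>r. strict_mono r \<and> averages_to T Z z r \<mu>)"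
  by (simp add: Vgen_def generates_def averages_to_def avg_def)

lemma averages_to_subseq:
  assumes "averages_to T Z z r \<mu>" "strict_mono s"
  shows "averages_to T Z z (r \<circ> s) \<mu>"
  using assms LIMSEQ_subseq_LIMSEQ unfolding averages_to_def by (fastforce simp: o_def)

lemma averages_to_imp_generated:
  assumes \<mu>: "prob_on Z \<mu>" and T: "continuous_on UNIV T" and r: "strict_mono r"
    and lim: "averages_to T Z z r \<mu>"
  shows "generated \<mu> T z r" and "AE x in \<mu>. x \<in> Z"
proof -
  interpret prob_space \<mu> using \<mu> by (simp add: prob_on_def)
  have sets: "sets \<mu> = sets borel" using \<mu> by (simp add: prob_on_def)
  show AE: "AE x in \<mu>. x \<in> Z"
    using \<mu> by (intro AE_prob_1) (simp add: prob_on_def measure_def)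
  \<comment> \<open>Measurability follows from \<open>emeasure \<mu> Z = 1\<close>, as a set outside
    \<open>sets \<mu>\<close> has \<open>emeasure\<close> 0.\<close>
  have Z: "Z \<in> sets \<mu>"
    using \<mu> emeasure_notin_sets[of Z \<mu>] by (auto simp: prob_on_def)
  show "generated \<mu> T z r"
  proof
    fix g :: "'a \<Rightarrow> real" assume g: "continuous_on UNIV g"
    have "g \<in> borel_measurable \<mu>"
      using borel_measurable_continuous_onI[OF g] sets by (simp cong: measurable_cong_sets)
    then have "(\<integral>x. indicator Z x * g x \<partial>\<mu>) = (\<integral>x. g x \<partial>\<mu>)"
      using AE Z by (intro integral_cong_AE) auto
    then show "(\<lambda>k. avg T z g (r k)) \<longlonglongrightarrow> (\<integral>x. g x \<partial>\<mu>)"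
      using lim continuous_on_subset[OF g, of Z] by (auto simp: averages_to_def)
  qed (use sets T r in auto)
qed

subsection \<open>Compactness\<close>

text \<open>Pushing the empirical measures forward along an embedding into the real line
  reduces weak compactness to Helly's selection theorem.\<close>

lemma empirical_measures_compact:
  fixes e :: "'a::metric_space \<Rightarrow> real" and x :: "nat \<Rightarrow> 'a" and r :: "nat \<Rightarrow> nat"
  assumes Z: "compact Z" and e: "continuous_on Z e" "inj_on e Z"
    and x: "\<And>i. x i \<in> Z" and r: "strict_mono r"
  obtains s \<nu> where "strict_mono s" "prob_on Z \<nu>"
    "\<And>g. continuous_on Z g \<Longrightarrow>
      (\<lambda>k. (\<Sum>i<r (s k). g (x i)) / real (r (s k))) \<longlonglongrightarrow> (\<integral>x. indicator Z x * g x \<partial>\<nu>)"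
proof -
  \<comment> \<open>The index is shifted by one since \<open>r 0\<close> may be \<open>0\<close>.\<close>
  define U where "U = (\<lambda>k. measure_pmf (pmf_of_set {..<r (Suc k)}))"
  define M where "M = (\<lambda>k. distr (U k) borel (\<lambda>i. e (x i)))"
  have r1: "r (Suc k) > 0" for k
    using strict_monoD[OF r, of k "Suc k"] by simp
  have ne: "{..<r (Suc k)} \<noteq> {}" for k using r1[of k] by blast
  have U: "prob_space (U k)" for k
    by (simp add: U_def measure_pmf.prob_space_axioms)
  have M: "real_distribution (M k)" for k
    unfolding M_def by (intro prob_space.real_distribution_distr U) (simp add: U_def)
  have int_M: "(\<integral>t. G t \<partial>M k) = (\<Sum>i<r (Suc k). G (e (x i))) / real (r (Suc k))"
    if "continuous_on UNIV G" for G :: "real \<Rightarrow> real" and k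
  proof -
    have "(\<integral>t. G t \<partial>M k) = (\<integral>i. G (e (x i)) \<partial>U k)"
      unfolding M_def using borel_measurable_continuous_onI[OF that]
      by (intro integral_distr) (simp_all add: U_def)
    then show ?thesis using ne[of k] by (simp add: U_def integral_pmf_of_set)
  qed
  define C where "C = e ` Z"
  have C: "compact C" "C \<noteq> {}" "closed C"
    using compact_continuous_image[OF e(1) Z] x[of 0] by (auto simp: C_def compact_imp_closed)
  have xC: "e (x i) \<in> C" for i using x by (simp add: C_def)
  obtain B where B: "\<And>t. t \<in> C \<Longrightarrow> \<bar>t\<bar> \<le> B"
    using compact_imp_bounded[OF C(1)] by (auto simp: bounded_iff)
  have "tight M"
    unfolding tight_def
  proof (intro conjI allI impI M)
    fix \<epsilon> :: real assume "\<epsilon> > 0"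
    \<comment> \<open>The interval is open on the left, so its endpoint has to lie strictly below
      \<open>- B\<close>.\<close>
    have "measure (M k) {- B - 1<..B} = 1" for k
    proof -
      have "(\<lambda>i. e (x i)) -` {- B - 1<..B} = UNIV"
        using B[OF xC] by (auto simp: abs_le_iff) (smt (verit) B xC)
      then have "measure (M k) {- B - 1<..B} = measure (U k) UNIV"
        unfolding M_def by (subst measure_distr) (simp_all add: U_def)
      then show ?thesis by (simp add: U_def)
    qed
    moreover have "- B - 1 < B" using B[OF xC[of 0]] by linarith
    ultimately show "\<exists>a b. a < b \<and> (\<forall>k. 1 - \<epsilon> < measure (M k) {a<..b})"
      using \<open>\<epsilon> > 0\<close> by (intro exI[of _ "- B - 1"] exI[of _ B]) auto
  qed
  from tight_imp_convergent_subsubsequence[OF this strict_mono_id]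
  obtain s N where s: "strict_mono s" and N: "real_distribution N" and conv: "weak_conv_m (M \<circ> id \<circ> s) N"
    by blast
  interpret N: real_distribution N by fact
  have lim: "(\<lambda>k. (\<Sum>i<r (Suc (s k)). G (e (x i))) / real (r (Suc (s k)))) \<longlonglongrightarrow> (\<integral>t. G t \<partial>N)"
    if G: "continuous_on UNIV G" "\<And>t. \<bar>G t\<bar> \<le> b" for G :: "real \<Rightarrow> real" and b
  proof -
    have "(\<lambda>k. \<integral>t. G t \<partial>(M \<circ> id \<circ> s) k) \<longlonglongrightarrow> (\<integral>t. G t \<partial>N)"
    proof (rule weak_conv_imp_integral_bdd_continuous_conv[OF _ N conv])
      show "isCont G t" for t using G(1) by (simp add: continuous_on_eq_continuous_at)
      show "norm (G t) \<le> b" for t using G(2) by simp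
    qed (simp add: M)
    then show ?thesis by (simp add: int_M[OF G(1)])
  qed
  have AE_C: "AE t in N. t \<in> C"
  proof -
    \<comment> \<open>The truncated distance to \<open>C\<close> vanishes exactly on
      \<open>C\<close>. It is 0 at every sample point, so its integral against the limit
      \<open>N\<close> is 0 too.\<close>
    let ?G = "\<lambda>t. min 1 (infdist t C)"
    have cont: "continuous_on UNIV ?G" by (intro continuous_intros)
    have "(\<lambda>k. (\<Sum>i<r (Suc (s k)). ?G (e (x i))) / real (r (Suc (s k)))) \<longlonglongrightarrow> (\<integral>t. ?G t \<partial>N)"
      by (rule lim[OF cont, of 1]) (simp add: infdist_nonneg)
    then have "(\<integral>t. ?G t \<partial>N) = 0"
      using xC by (simp add: LIMSEQ_const_iff)
    moreover have "integrable N ?G"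
      using borel_measurable_continuous_onI[OF cont]
      by (intro N.integrable_const_bound[where B=1]) (auto simp: infdist_nonneg)
    ultimately have "AE t in N. ?G t = 0"
      by (subst (asm) integral_nonneg_eq_0_iff_AE) (auto simp: infdist_nonneg)
    then show ?thesis
      by eventually_elim (use in_closed_iff_infdist_zero[OF C(3,2)] in \<open>auto simp: min_def split: if_splits\<close>)
  qed
  define d where "d = inv_into Z e"
  \<comment> \<open>A continuous injection of a compact set has a continuous inverse on its
    image.\<close>
  have d: "continuous_on C d"
    unfolding C_def d_def using e
    by (intro continuous_on_inv[OF e(1) Z]) (auto simp: inv_into_f_f)
  have dZ: "d t \<in> Z" if "t \<in> C" for t
    using that by (auto simp: C_def d_def inv_into_into)
  have de: "d (e y) = y" if "y \<in> Z" for y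
    using that e(2) by (simp add: d_def)
  \<comment> \<open>Off \<open>C\<close>, which is null for \<open>N\<close>, the value is an
    arbitrary point of \<open>Z\<close>; thus \<open>\<phi>\<close> maps everything into
    \<open>Z\<close>.\<close>
  define \<phi> where "\<phi> = (\<lambda>t. if t \<in> C then d t else x 0)"
  have \<phi>: "\<phi> \<in> borel_measurable borel"
    unfolding \<phi>_def using C(3) by (intro borel_measurable_continuous_on_if d) auto
  have \<phi>N: "\<phi> \<in> borel_measurable N" using \<phi> by simp
  have \<phi>Z: "\<phi> t \<in> Z" for t by (simp add: \<phi>_def dZ x)
  define \<nu> where "\<nu> = distr N borel \<phi>"
  have Zb: "Z \<in> sets borel" using Z by (simp add: borel_compact)
  show ?thesis
  proof (rule that)
    show "strict_mono (Suc \<circ> s)" using s by (simp add: strict_mono_def)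
    have "emeasure \<nu> Z = emeasure N UNIV"
      unfolding \<nu>_def using \<phi>Z by (subst emeasure_distr[OF \<phi>N Zb]) (simp add: vimage_def)
    then show "prob_on Z \<nu>"
      using N.emeasure_space_1 N.prob_space_distr[OF \<phi>N] by (simp add: prob_on_def \<nu>_def)
    fix g :: "'a \<Rightarrow> real" assume g: "continuous_on Z g"
    obtain b where "\<forall>t\<in>g ` Z. norm t \<le> b"
      using compact_imp_bounded[OF compact_continuous_image[OF g Z]] by (auto simp: bounded_iff)
    then have b: "\<bar>g y\<bar> \<le> b" if "y \<in> Z" for y using that by simp
    have b0: "0 \<le> b" using b[OF x[of 0]] by linarith
    have "continuous_on C (\<lambda>t. g (d t))"
      by (rule continuous_on_compose2[OF g d]) (use dZ in auto)
    \<comment> \<open>Weak convergence on the line tests bounded functions that are continuous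
      everywhere, whereas \<open>g \<circ> d\<close> is continuous only on \<open>C\<close>; hence
      the Tietze extension.\<close>
    then obtain G where G: "continuous_on UNIV G" "\<And>t. t \<in> C \<Longrightarrow> G t = g (d t)" "\<And>t. \<bar>G t\<bar> \<le> b"
      by (rule Tietze[where U=UNIV and B=b]) (use C b b0 dZ in auto)
    have "(\<integral>y. indicator Z y * g y \<partial>\<nu>) = (\<integral>t. indicator Z (\<phi> t) * g (\<phi> t) \<partial>N)"
      unfolding \<nu>_def using borel_measurable_continuous_on_indicator[OF Zb g]
      by (intro integral_distr \<phi>N) simp
    also have "\<dots> = (\<integral>t. G t \<partial>N)"
    proof (rule integral_cong_AE)
      show "(\<lambda>t. indicator Z (\<phi> t) * g (\<phi> t)) \<in> borel_measurable N"
        using measurable_compose[OF \<phi>N, of "\<lambda>y. indicator Z y * g y"]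
          borel_measurable_continuous_on_indicator[OF Zb g] by simp
      show "G \<in> borel_measurable N" using borel_measurable_continuous_onI[OF G(1)] by simp
      show "AE t in N. indicator Z (\<phi> t) * g (\<phi> t) = G t"
        using AE_C by eventually_elim (use \<phi>Z in \<open>simp add: \<phi>_def G dZ\<close>)
    qed
    finally have "(\<integral>y. indicator Z y * g y \<partial>\<nu>) = (\<integral>t. G t \<partial>N)" .
    then show "(\<lambda>k. (\<Sum>i<r ((Suc \<circ> s) k). g (x i)) / real (r ((Suc \<circ> s) k)))
        \<longlonglongrightarrow> (\<integral>x. indicator Z x * g x \<partial>\<nu>)"
      using lim[OF G(1,3)] by (simp add: G(2) xC de x)
  qed
qed

section \<open>The sequence space \<open>Omega2\<close>: embedding into the line and
  compactness\<close>

lemma ternary_expansion_zero: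
  fixes a :: "nat \<Rightarrow> real"
  assumes "\<And>n. a n \<in> {-1, 0, 1}" "(\<Sum>n. a n * (1/3) ^ n) = 0"
  shows "a n = 0"
proof -
  have tail: "a 0 = 0 \<and> (\<Sum>n. a (Suc n) * (1/3) ^ n) = 0"
    if a: "\<And>n. a n \<in> {-1, 0, 1}" and s: "(\<Sum>n. a n * (1/3) ^ n) = 0" for a :: "nat \<Rightarrow> real"
  proof -
    have norm: "norm (a n * (1/3) ^ n) \<le> (1/3) ^ n" for n
      using a[of n] by (auto simp: abs_mult)
    have norm': "norm (a (Suc n) * (1/3) ^ n) \<le> (1/3) ^ n" for n
      using a[of "Suc n"] by (auto simp: abs_mult)
    have geo: "summable (\<lambda>n. (1/3 :: real) ^ n)" "(\<Sum>n. (1/3 :: real) ^ n) = 3 / 2"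
      using summable_geometric[of "1/3 :: real"] suminf_geometric[of "1/3 :: real"] by auto
    have sm: "summable (\<lambda>n. a n * (1/3) ^ n)" "summable (\<lambda>n. a (Suc n) * (1/3) ^ n)"
      using norm norm' by (auto intro: summable_comparison_test'[OF geo(1), of 0])
    have "(\<Sum>n. a n * (1/3) ^ n) = a 0 + (\<Sum>n. a (Suc n) * (1/3) ^ Suc n)"
      using suminf_split_head[OF sm(1)] by simp
    also have "(\<Sum>n. a (Suc n) * (1/3) ^ Suc n) = 1/3 * (\<Sum>n. a (Suc n) * (1/3) ^ n)"
      using suminf_mult[OF sm(2), of "1/3"] by (simp add: mult.left_commute)
    finally have eq: "a 0 + 1/3 * (\<Sum>n. a (Suc n) * (1/3) ^ n) = 0" using s by simp
    \<comment> \<open>The tail enters with factor \<open>1/3\<close>, so it contributes at most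
      \<open>1/2\<close> and cannot cancel a leading digit 1 or -1.\<close>
    have "\<bar>\<Sum>n. a (Suc n) * (1/3) ^ n\<bar> \<le> 3 / 2"
      using norm_suminf_le[OF norm' geo(1)] geo(2) by simp
    with eq a[of 0] show ?thesis by auto
  qed
  show ?thesis using assms
  proof (induction n arbitrary: a)
    case 0
    then show ?case using tail[OF 0] by simp
  next
    case (Suc n)
    have "(\<lambda>n. a (Suc n)) n = 0"
      by (rule Suc.IH) (use Suc.prems(1) tail[OF Suc.prems] in simp_all)
    then show ?case .
  qed
qed

text \<open>Coordinates, listed by \<open>int_decode\<close>, become digits 0 and 1 in base 3. Two
  expansions differ by one with digits -1, 0, 1, so \<open>ternary_expansion_zero\<close> gives
  injectivity, which base 2 would not. Continuity is that of a uniform limit.\<close>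

lemma Omega2_embedding:
  obtains e :: "(int \<Rightarrow> real) \<Rightarrow> real" where "continuous_on Omega2 e" "inj_on e Omega2"
proof
  let ?f = "\<lambda>n (\<omega> :: int \<Rightarrow> real). \<omega> (int_decode n) * (1/3) ^ n"
  let ?e = "\<lambda>\<omega>. \<Sum>n. ?f n \<omega>"
  have norm: "norm (?f n \<omega>) \<le> (1/3) ^ n" if "\<omega> \<in> Omega2" for n \<omega>
  proof -
    have "\<omega> (int_decode n) \<in> {0, 1}" using that by (simp only: Omega2_def mem_Collect_eq)
    then show ?thesis by auto
  qed
  have geo: "summable (\<lambda>n. (1/3 :: real) ^ n)"
    by (rule summable_geometric) simp
  have "uniform_limit Omega2 (\<lambda>n \<omega>. \<Sum>i<n. ?f i \<omega>) ?e sequentially"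
    by (rule Weierstrass_m_test[OF norm geo])
  then show "continuous_on Omega2 ?e"
  proof (rule uniform_limit_theorem[rotated])
    have "continuous_on Omega2 (\<lambda>\<omega>. \<Sum>i<n. ?f i \<omega>)" for n
      by (intro continuous_intros continuous_on_subset[OF continuous_on_product_coordinates]) simp
    then show "\<forall>\<^sub>F n in sequentially. continuous_on Omega2 (\<lambda>\<omega>. \<Sum>i<n. ?f i \<omega>)"
      by simp
  qed simp
  show "inj_on ?e Omega2"
  proof (rule inj_onI)
    fix \<omega> \<omega>' assume \<omega>: "\<omega> \<in> Omega2" "\<omega>' \<in> Omega2" and eq: "?e \<omega> = ?e \<omega>'"
    let ?a = "\<lambda>n. \<omega> (int_decode n) - \<omega>' (int_decode n)"
    have "summable (\<lambda>n. ?f n \<omega>)" "summable (\<lambda>n. ?f n \<omega>')"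
      using norm \<omega> by (auto intro: summable_comparison_test'[OF geo, of 0])
    then have "(\<Sum>n. ?a n * (1/3) ^ n) = 0"
      using eq by (simp add: left_diff_distrib suminf_diff[symmetric])
    moreover have "?a n \<in> {-1, 0, 1}" for n
    proof -
      have "\<omega> (int_decode n) \<in> {0, 1}" "\<omega>' (int_decode n) \<in> {0, 1}"
        using \<omega> by (simp_all only: Omega2_def mem_Collect_eq)
      then show ?thesis by auto
    qed
    ultimately have a: "?a n = 0" for n by (rule ternary_expansion_zero[rotated])
    have "\<omega> i = \<omega>' i" for i using a[of "int_encode i"] by simp
    then show "\<omega> = \<omega>'" by blast
  qed
qed

lemma compact_Omega2: "compact Omega2"
proof -
  have "compactin (product_topology (\<lambda>_. euclidean) UNIV) (PiE UNIV (\<lambda>_ :: int. {0, 1 :: real}))"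
    by (simp add: compactin_PiE)
  also have "PiE UNIV (\<lambda>_ :: int. {0, 1 :: real}) = Omega2"
    by (auto simp: Omega2_def PiE_iff)
  finally show ?thesis by (simp add: euclidean_product_topology)
qed

lemma continuous_on_shift: "continuous_on UNIV shift"
  unfolding shift_def
  by (intro continuous_on_coordinatewise_then_product continuous_on_product_coordinates)

lemma funpow_shift: "(shift ^^ t) \<omega> i = \<omega> (i + int t)"
  by (induction t arbitrary: i) (simp_all add: shift_def ac_simps)

lemma funpow_shift_in_Omega2: "\<omega> \<in> Omega2 \<Longrightarrow> (shift ^^ t) \<omega> \<in> Omega2"
  by (simp add: Omega2_def funpow_shift)

lemma averages_to_subseq_exists:
  fixes r :: "nat \<Rightarrow> nat"
  assumes "\<omega> \<in> Omega2" "strict_mono r"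
  obtains s \<nu> where "strict_mono s" "prob_on Omega2 \<nu>" "averages_to shift Omega2 \<omega> (r \<circ> s) \<nu>"
proof -
  obtain e :: "(int \<Rightarrow> real) \<Rightarrow> real" where e: "continuous_on Omega2 e" "inj_on e Omega2"
    by (rule Omega2_embedding)
  show thesis
  proof (rule empirical_measures_compact[where x="\<lambda>i. (shift ^^ i) \<omega>",
        OF compact_Omega2 e funpow_shift_in_Omega2[OF assms(1)] assms(2)])
    fix s \<nu>
    assume "strict_mono s" "prob_on Omega2 \<nu>"
      and "\<And>g. continuous_on Omega2 g \<Longrightarrow>
        (\<lambda>k. (\<Sum>i<r (s k). g ((shift ^^ i) \<omega>)) / real (r (s k))) \<longlonglongrightarrow> (\<integral>x. indicator Omega2 x * g x \<partial>\<nu>)"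
    then show thesis
      by (intro that[of s \<nu>]) (simp_all add: averages_to_def avg_def)
  qed
qed

lemma char_seq_in_Omega2: "char_seq J \<in> Omega2"
  by (simp add: Omega2_def char_seq_def)

subsection \<open>The three word processes\<close>

text \<open>On \<open>Omega2\<close> this says that the letter at 0 is 1. The threshold
  \<open>1/2\<close> makes it a superlevel set of a continuous function at a level that
  \<open>Omega2\<close> never attains, as \<open>squeezed_superlevel\<close> requires.\<close>

definition one_at_zero :: "(int \<Rightarrow> real) set" where
  "one_at_zero = {\<omega>. \<omega> 0 > 1/2}"

lemma squeezed_one_at_zero:
  assumes "generated \<nu> T z r" "AE \<omega> in \<nu>. \<omega> \<in> Omega2"
  shows "generated.squeezed \<nu> (indicator one_at_zero)"
proof -
  interpret generated \<nu> T z r by fact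
  have "{\<omega> :: int \<Rightarrow> real. \<omega> 0 = 1/2} \<in> sets \<nu>"
    unfolding sets_eq
    by (intro borel_closed closed_Collect_eq continuous_on_product_coordinates continuous_on_const)
  moreover have "AE \<omega> in \<nu>. \<omega> \<notin> {\<omega>. \<omega> 0 = 1/2}"
    using assms(2)
  proof eventually_elim
    case (elim \<omega>)
    then have "\<omega> 0 \<in> {0, 1}" by (simp only: Omega2_def mem_Collect_eq)
    then show ?case by auto
  qed
  ultimately have "measure \<nu> {\<omega>. \<omega> 0 = 1/2} = 0"
    by (simp add: AE_iff_measurable[OF _ refl] prob_eq_0)
  then show ?thesis
    unfolding one_at_zero_def by (rule squeezed_superlevel[OF continuous_on_product_coordinates])
qed

text \<open>Cells and cylinders agree only for sequences with letters 0 and 1, hence up to a null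
  set.\<close>

lemma bernoulli_half_cell:
  assumes \<xi>: "bernoulli_half \<xi>" and AE: "AE \<omega> in \<xi>. \<omega> \<in> Omega2"
    and meas: "cell shift one_at_zero u \<in> sets \<xi>"
  shows "measure \<xi> (cell shift one_at_zero u) = (1/2) ^ length u"
proof -
  interpret prob_space \<xi> using \<xi> by (simp add: bernoulli_half_def prob_on_def)
  have sets: "sets \<xi> = sets borel" using \<xi> by (simp add: bernoulli_half_def prob_on_def)
  let ?v = "map (\<lambda>b. if b then 1 else 0 :: real) u"
  let ?C = "{\<omega>. \<forall>i<length ?v. \<omega> (int i) = ?v ! i}"
  have "closed (\<Inter>i\<in>{..<length ?v}. {\<omega> :: int \<Rightarrow> real. \<omega> (int i) = ?v ! i})"
    by (intro closed_INT ballI closed_Collect_eq continuous_on_product_coordinates continuous_on_const)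
  also have "(\<Inter>i\<in>{..<length ?v}. {\<omega> :: int \<Rightarrow> real. \<omega> (int i) = ?v ! i}) = ?C" by auto
  finally have C: "?C \<in> sets \<xi>" unfolding sets by (rule borel_closed)
  have "measure \<xi> (cell shift one_at_zero u) = measure \<xi> ?C"
  proof (rule finite_measure_eq_AE[OF _ meas C])
    show "AE \<omega> in \<xi>. \<omega> \<in> cell shift one_at_zero u \<longleftrightarrow> \<omega> \<in> ?C"
      using AE
    proof eventually_elim
      case (elim \<omega>)
      have "(\<omega> (int i) > 1/2) = u ! i \<longleftrightarrow> \<omega> (int i) = (if u ! i then 1 else 0)" for i
      proof -
        have "\<omega> (int i) \<in> {0, 1}" using elim by (simp only: Omega2_def mem_Collect_eq)
        then show ?thesis by auto
      qed
      then show ?case by (simp add: cell_def one_at_zero_def funpow_shift)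
    qed
  qed
  also have "set ?v \<subseteq> {0, 1}" by auto
  then have "measure \<xi> ?C = (1/2) ^ length ?v"
    using \<xi> unfolding bernoulli_half_def by blast
  finally show ?thesis by simp
qed

lemma word_entropy_uniform:
  assumes "\<And>u. u \<in> words n \<Longrightarrow> p u = (1/2) ^ n"
  shows "word_entropy p n = real n * ln 2"
proof -
  have "word_entropy p n = (\<Sum>u\<in>words n. - ((1/2) ^ n * ln ((1/2) ^ n)))"
    unfolding word_entropy_def using assms by (intro sum.cong) auto
  also have "\<dots> = - (2 ^ n * (1/2) ^ n) * (real n * ln (1/2))"
    by (simp add: card_words ln_realpow)
  also have "\<dots> = real n * ln 2"
    by (simp add: ln_div power_one_over)
  finally show ?thesis .
qed

lemma zeros_eq_sum: "real (zeros y) = (\<Sum>i<length y. if y ! i then 0 else 1)"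
  by (induction y) (simp_all add: zeros_def sum.lessThan_Suc_shift del: sum.lessThan_Suc)

text \<open>For each offset \<open>i < m\<close>, the times \<open>t + i\<close> with
  \<open>t < n\<close> run through the window \<open>{..<n}\<close> moved by \<open>i\<close>. At
  most \<open>i\<close> of them leave the window, which costs at most the extra
  \<open>real m\<close>.\<close>

lemma sum_zeros_le:
  assumes y: "\<And>t i. i < m \<Longrightarrow> Y t ! i \<longleftrightarrow> t + i \<in> J" and len: "\<And>t. length (Y t) = m"
  shows "(\<Sum>t<n. real (zeros (Y t))) \<le> real m * (real n - real (card (J \<inter> {..<n})) + real m)"
proof -
  have "(\<Sum>t<n. real (zeros (Y t))) = (\<Sum>i<m. \<Sum>t<n. if t + i \<in> J then 0 else 1)"
    unfolding zeros_eq_sum len by (subst sum.swap) (intro sum.cong refl, simp add: y)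
  also have "\<dots> \<le> (\<Sum>i<m. real n - real (card (J \<inter> {..<n})) + real m)"
  proof (rule sum_mono)
    fix i assume i: "i \<in> {..<m}"
    have "(\<Sum>t<n. if t + i \<in> J then 0 else 1 :: real) = real (card {t\<in>{..<n}. t + i \<notin> J})"
      by (simp add: sum.If_cases Int_def)
    also have "card {t\<in>{..<n}. t + i \<notin> J} = card ((\<lambda>t. t + i) ` {t\<in>{..<n}. t + i \<notin> J})"
      by (simp add: card_image)
    also have "\<dots> \<le> card (({..<n} - J) \<union> {n..<n + i})"
      by (rule card_mono) auto
    also have "\<dots> \<le> card ({..<n} - J) + i"
      using card_Un_le[of "{..<n} - J" "{n..<n + i}"] by simp
    also have "card ({..<n} - J) = n - card (J \<inter> {..<n})"
      by (simp add: card_Diff_subset_Int Int_commute)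
    finally show "(\<Sum>t<n. if t + i \<in> J then 0 else 1) \<le> real n - real (card (J \<inter> {..<n})) + real m"
      using i card_mono[of "{..<n}" "J \<inter> {..<n}"] by (simp add: of_nat_diff)
  qed
  also have "\<dots> = real m * (real n - real (card (J \<inter> {..<n})) + real m)" by simp
  finally show ?thesis .
qed

lemma lower_density_eventually:
  assumes "lower_density J > 0" "d < lower_density J"
  shows "eventually (\<lambda>n. d < real (card (J \<inter> {..<n})) / real n) sequentially"
proof -
  let ?L = "liminf (\<lambda>N. ereal (real (card (J \<inter> {..<N})) / real N))"
  \<comment> \<open>\<open>real_of_ereal\<close> sends infinite values to 0, so positivity of
    \<open>lower_density J\<close> rules them out.\<close>
  have "ereal (lower_density J) = ?L"
    using assms(1) unfolding lower_density_def by (cases ?L) auto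
  then have "ereal d < ?L" using assms(2) by (metis ereal_less(1) less_ereal.simps(1))
  then have "eventually (\<lambda>n. ereal d < ereal (real (card (J \<inter> {..<n})) / real n)) sequentially"
    by (rule less_LiminfD)
  then show ?thesis by simp
qed

text \<open>A Urysohn function \<open>h\<close> is 0 on \<open>K0\<close> and 1 on
  \<open>K1\<close>. The law of \<open>h\<close> has at most countably many atoms, so some level
  \<open>c\<close> strictly between 0 and 1 is null.\<close>

lemma superlevel_separation:
  fixes K0 K1 :: "'a::metric_space set"
  assumes "prob_space \<mu>" and sets: "sets \<mu> = sets borel"
    and K: "closed K0" "closed K1" "K0 \<inter> K1 = {}"
  obtains h :: "'a \<Rightarrow> real" and c where "continuous_on UNIV h" "measure \<mu> {x. h x = c} = 0"
    "\<And>x. x \<in> K0 \<Longrightarrow> \<not> h x > c" "\<And>x. x \<in> K1 \<Longrightarrow> h x > c"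
proof -
  interpret prob_space \<mu> by fact
  have "normal_space (euclidean :: 'a topology)"
    by (intro metrizable_imp_normal_space metrizable_space_euclidean)
  then obtain h :: "'a \<Rightarrow> real" where h: "continuous_map euclidean euclideanreal h"
      "h ` K0 \<subseteq> {0}" "h ` K1 \<subseteq> {1}"
    by (rule Urysohn_lemma_alt[of _ K0 K1]) (use K in \<open>auto simp: disjnt_def\<close>)
  have cont: "continuous_on UNIV h" using h(1) by simp
  have meas: "h \<in> borel_measurable \<mu>"
    using borel_measurable_continuous_onI[OF cont] sets by (simp cong: measurable_cong_sets)
  interpret D: prob_space "distr \<mu> borel h" by (rule prob_space_distr[OF meas])
  have "countable {c. measure (distr \<mu> borel h) {c} \<noteq> 0}"
    by (rule D.countable_support)
  then have "\<not> {0<..<1} \<subseteq> {c. measure (distr \<mu> borel h) {c} \<noteq> 0}"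
    using uncountable_open_interval[of 0 "1::real"] countable_subset by auto
  then obtain c :: real where c: "0 < c" "c < 1" "measure (distr \<mu> borel h) {c} = 0"
    by auto
  have "measure \<mu> {x. h x = c} = measure (distr \<mu> borel h) {c}"
    using sets_eq_imp_space_eq[OF sets] by (subst measure_distr[OF meas]) (auto simp: vimage_def)
  then show thesis
    using that[of h c] cont c h(2,3) by force
qed

text \<open>\<open>entropy_of_agreeing_words\<close> for a uniform time below \<open>r k\<close>, in
  the limit of large \<open>k\<close> with \<open>n\<close> fixed. A number \<open>d\<close>
  strictly below the lower density is used because the density of \<open>J\<close> in
  \<open>{..<r k}\<close> eventually exceeds it.\<close>

lemma word_entropy_inequality:
  fixes f :: "'a::metric_space \<Rightarrow> 'a"
  assumes A: "generated \<mu> f x r" "generated.squeezed \<mu> (indicator P)"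
    and B: "generated \<nu> shift (char_seq J) r" "AE \<omega> in \<nu>. \<omega> \<in> Omega2"
    and C: "generated \<xi> shift \<omega> r" "AE \<omega> in \<xi>. \<omega> \<in> Omega2" "bernoulli_half \<xi>"
    and visits: "\<And>j. j \<in> J \<Longrightarrow> (f ^^ j) x \<in> P \<longleftrightarrow> \<omega> (int j) > 1/2"
    and d: "lower_density J > 0" "d < lower_density J"
  shows "real n * ln 2 \<le> word_entropy (\<lambda>u. measure \<mu> (cell f P u)) n
     + word_entropy (\<lambda>u. measure \<nu> (cell shift one_at_zero u)) n + real n * (1 - d) * ln 2"
proof -
  interpret A: generated \<mu> f x r by fact
  interpret B: generated \<nu> shift "char_seq J" r by fact
  interpret C: generated \<xi> shift \<omega> r by fact
  define W where "W = block shift one_at_zero \<omega> n"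
  define N where "N = block f P x n"
  define Y where "Y = block shift one_at_zero (char_seq J) n"
  define H where "H = (\<lambda>X k. word_entropy (freq {..<r k} X) n)"
  have Y_nth: "Y t ! i \<longleftrightarrow> t + i \<in> J" if "i < n" for t i
    using that by (simp add: Y_def one_at_zero_def funpow_shift char_seq_def nat_add_distrib)
  have W_nth: "W t ! i \<longleftrightarrow> \<omega> (int (t + i)) > 1/2" if "i < n" for t i
    using that by (simp add: W_def one_at_zero_def funpow_shift)
  have sqB: "B.squeezed (indicator one_at_zero)" by (rule squeezed_one_at_zero[OF B])
  have sqC: "C.squeezed (indicator one_at_zero)" by (rule squeezed_one_at_zero[OF C(1,2)])
  have limN: "H N \<longlonglongrightarrow> word_entropy (\<lambda>u. measure \<mu> (cell f P u)) n"
    unfolding H_def N_def by (rule A.block_entropy_tendsto[OF A(2)])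
  have limY: "H Y \<longlonglongrightarrow> word_entropy (\<lambda>u. measure \<nu> (cell shift one_at_zero u)) n"
    unfolding H_def Y_def by (rule B.block_entropy_tendsto[OF sqB])
  have "word_entropy (\<lambda>u. measure \<xi> (cell shift one_at_zero u)) n = real n * ln 2"
    using bernoulli_half_cell[OF C(3,2)] C.cell_sets[OF sqC]
    by (intro word_entropy_uniform) (auto simp: C.sets_eq)
  then have limW: "H W \<longlonglongrightarrow> real n * ln 2"
    using C.block_entropy_tendsto[OF sqC, of n] by (simp add: H_def W_def)
  \<comment> \<open>The term with \<open>inverse (real (r k))\<close> pays for words that reach
    beyond time \<open>r k\<close>; it vanishes in the limit.\<close>
  let ?E = "\<lambda>k. real n * (1 - d + real n * inverse (real (r k))) * ln 2"
  have lim: "(\<lambda>k. H N k + H Y k + ?E k) \<longlonglongrightarrow>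
      word_entropy (\<lambda>u. measure \<mu> (cell f P u)) n + word_entropy (\<lambda>u. measure \<nu> (cell shift one_at_zero u)) n
      + real n * (1 - d + real n * 0) * ln 2"
    by (intro tendsto_intros limN limY A.inverse_r_tendsto)
  have r: "filterlim r sequentially sequentially"
    using A.strict_mono_r by (rule filterlim_subseq)
  have "eventually (\<lambda>k. d < real (card (J \<inter> {..<r k})) / real (r k)) sequentially"
    by (rule eventually_compose_filterlim[OF lower_density_eventually[OF d] r])
  moreover have "eventually (\<lambda>k. 0 < r k) sequentially"
    by (rule eventually_compose_filterlim[OF eventually_gt_at_top r])
  ultimately have "eventually (\<lambda>k. H W k \<le> H N k + H Y k + ?E k) sequentially"
  proof eventually_elim
    case (elim k)
    let ?c = "real (card (J \<inter> {..<r k}))"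
    have "H W k \<le> H N k + H Y k + (\<Sum>t<r k. real (zeros (Y t))) / real (card {..<r k}) * ln 2"
      unfolding H_def
    proof (rule entropy_of_agreeing_words)
      show "{..<r k} \<noteq> {}" using elim by blast
      show "W t ! i = N t ! i" if "i < n" "Y t ! i" for t i
        using that W_nth[OF that(1), of t] Y_nth[OF that(1), of t] visits[of "t + i"]
        by (simp add: N_def)
    qed (simp_all add: W_def N_def Y_def)
    moreover have "(\<Sum>t<r k. real (zeros (Y t))) / real (card {..<r k}) * ln 2 \<le> ?E k"
    proof -
      have "(\<Sum>t<r k. real (zeros (Y t))) / real (r k) \<le> real n * (real (r k) - ?c + real n) / real (r k)"
        using Y_nth by (intro divide_right_mono sum_zeros_le) (simp_all add: Y_def)
      also have "\<dots> = real n * (1 - ?c / real (r k) + real n * inverse (real (r k)))"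
        using elim by (simp add: field_simps)
      also have "\<dots> \<le> real n * (1 - d + real n * inverse (real (r k)))"
        using elim by (intro mult_left_mono) auto
      finally show ?thesis by (intro mult_right_mono) auto
    qed
    ultimately show ?case by linarith
  qed
  from tendsto_le[OF sequentially_bot lim limW this] show ?thesis by simp
qed

section \<open>The entropy bound for the measures generated by \<open>xbar\<close>\<close>

theorem theorem3:
  fixes f :: "'a::metric_space \<Rightarrow> 'a"
    and K :: "nat \<Rightarrow> 'a set"
    and J :: "nat set"
    and xbar :: 'a
  assumes "compact (UNIV :: 'a set)"
    and "continuous_on UNIV f"
    and "compact (K 0)" and "compact (K 1)" and "K 0 \<inter> K 1 = {}"
    and "completely_deterministic J"
    and "lower_density J > 0"
    and "\<exists>\<omega>\<in>Omega2. (\<exists>\<xi>. bernoulli_half \<xi> \<and> generic_point shift Omega2 \<omega> \<xi>) \<and>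
           (\<forall>j\<in>J. (f ^^ j) xbar \<in> K (if \<omega> (int j) = 0 then 0 else 1))"
  shows "\<forall>\<mu>\<in>Vgen f UNIV xbar.
           metric_entropy \<mu> f \<ge> ereal (lower_density J * ln 2) \<and>
           lower_density J * ln 2 > 0"
proof (intro ballI conjI)
  show "lower_density J * ln 2 > 0" using assms(7) by simp
  fix \<mu> assume "\<mu> \<in> Vgen f UNIV xbar"
  then obtain r0 where \<mu>: "prob_on UNIV \<mu>" "strict_mono r0" "averages_to f UNIV xbar r0 \<mu>"
    by (auto simp: Vgen_iff)
  obtain \<omega> \<xi> where \<omega>: "\<omega> \<in> Omega2" "bernoulli_half \<xi>" "Vgen shift Omega2 \<omega> = {\<xi>}"
    and visits: "\<And>j. j \<in> J \<Longrightarrow> (f ^^ j) xbar \<in> K (if \<omega> (int j) = 0 then 0 else 1)"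
    using assms(8) unfolding generic_point_def by blast
  \<comment> \<open>A first thinning makes \<open>\<omega>\<close> generate some measure, which is
    \<open>\<xi>\<close> by genericity; a second one does the same for the characteristic sequence
    of \<open>J\<close>. Limits found earlier survive thinning.\<close>
  obtain s1 \<xi>' where s1: "strict_mono s1" "prob_on Omega2 \<xi>'" "averages_to shift Omega2 \<omega> (r0 \<circ> s1) \<xi>'"
    by (rule averages_to_subseq_exists[OF \<omega>(1) \<mu>(2)])
  have r1: "strict_mono (r0 \<circ> s1)" using \<mu>(2) s1(1) by (rule strict_mono_o)
  have "\<xi>' \<in> Vgen shift Omega2 \<omega>" using s1 r1 unfolding Vgen_iff by blast
  with \<omega>(3) have \<xi>': "\<xi>' = \<xi>" by simp
  obtain s2 \<nu> where s2: "strict_mono s2" "prob_on Omega2 \<nu>"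
      "averages_to shift Omega2 (char_seq J) (r0 \<circ> s1 \<circ> s2) \<nu>"
    by (rule averages_to_subseq_exists[OF char_seq_in_Omega2 r1])
  define r where "r = r0 \<circ> s1 \<circ> s2"
  have r: "strict_mono r" unfolding r_def using r1 s2(1) by (rule strict_mono_o)
  have "averages_to f UNIV xbar r \<mu>"
    unfolding r_def by (intro averages_to_subseq \<mu> s1 s2)
  then have A: "generated \<mu> f xbar r"
    by (rule averages_to_imp_generated[OF \<mu>(1) assms(2) r])
  have "averages_to shift Omega2 \<omega> r \<xi>"
    unfolding r_def using s1(3) s2(1) unfolding \<xi>' by (rule averages_to_subseq)
  note C = averages_to_imp_generated[OF s1(2)[unfolded \<xi>'] continuous_on_shift r this]
  note B = averages_to_imp_generated[OF s2(2) continuous_on_shift r s2(3)[folded r_def]]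
  interpret A: generated \<mu> f xbar r by (rule A)
  interpret B: generated \<nu> shift "char_seq J" r by (rule B)
  obtain h :: "'a \<Rightarrow> real" and c where h: "continuous_on UNIV h" "measure \<mu> {x. h x = c} = 0"
    "\<And>x. x \<in> K 0 \<Longrightarrow> \<not> h x > c" "\<And>x. x \<in> K 1 \<Longrightarrow> h x > c"
    by (rule superlevel_separation[of \<mu> "K 0" "K 1"])
      (use assms(3-5) A.prob_space_axioms A.sets_eq in \<open>auto intro: compact_imp_closed\<close>)
  define P where "P = {x. h x > c}"
  have sqA: "A.squeezed (indicator P)"
    unfolding P_def by (rule A.squeezed_superlevel[OF h(1,2)])
  have sqB: "B.squeezed (indicator one_at_zero)" by (rule squeezed_one_at_zero[OF B])
  have P_iff: "(f ^^ j) xbar \<in> P \<longleftrightarrow> \<omega> (int j) > 1/2" if "j \<in> J" for j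
  proof -
    have "\<omega> (int j) \<in> {0, 1}" using \<omega>(1) by (simp only: Omega2_def mem_Collect_eq)
    then show ?thesis using visits[OF that] h(3,4) by (auto simp: P_def)
  qed
  have "\<nu> \<in> Vgen shift Omega2 (char_seq J)"
    using s2(2) s2(3)[folded r_def] r unfolding Vgen_iff by blast
  then have "metric_entropy \<nu> shift = 0"
    using assms(6) by (simp add: completely_deterministic_def)
  with B.entropy_part_le_metric_entropy[OF sqB]
  have h\<nu>: "entropy_part \<nu> shift {one_at_zero, - one_at_zero} \<le> 0" by simp
  have "d * ln 2 \<le> entropy_part \<mu> f {P, - P}" if d: "d < lower_density J" for d
  proof -
    let ?H = "\<lambda>n. word_entropy (\<lambda>u. measure \<mu> (cell f P u)) n / real n
      + word_entropy (\<lambda>u. measure \<nu> (cell shift one_at_zero u)) n / real n"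
    have "d * ln 2 \<le> ?H n" if "n \<ge> 1" for n
    proof -
      \<comment> \<open>The missing bits \<open>real n * (1 - d) * ln 2\<close> are subtracted from
        \<open>real n * ln 2\<close>.\<close>
      have "real n * (d * ln 2) \<le> word_entropy (\<lambda>u. measure \<mu> (cell f P u)) n
          + word_entropy (\<lambda>u. measure \<nu> (cell shift one_at_zero u)) n"
        using word_entropy_inequality[OF A sqA B C \<omega>(2) P_iff assms(7) d, of n]
        by (simp add: algebra_simps)
      then show ?thesis using that by (simp add: field_simps)
    qed
    moreover have "?H \<longlonglongrightarrow> entropy_part \<mu> f {P, - P} + entropy_part \<nu> shift {one_at_zero, - one_at_zero}"
      by (intro tendsto_add A.entropy_part_tendsto[OF sqA] B.entropy_part_tendsto[OF sqB])
    ultimately have "d * ln 2 \<le> entropy_part \<mu> f {P, - P} + entropy_part \<nu> shift {one_at_zero, - one_at_zero}"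
      by (intro LIMSEQ_le_const) auto
    then show ?thesis using h\<nu> by simp
  qed
  \<comment> \<open>Isolating \<open>d\<close> allows \<open>dense_le\<close> to pass from all
    \<open>d\<close> below the lower density to the lower density itself.\<close>
  then have "d \<le> entropy_part \<mu> f {P, - P} / ln 2" if "d < lower_density J" for d
    using that by (simp add: le_divide_eq)
  then have "lower_density J \<le> entropy_part \<mu> f {P, - P} / ln 2"
    by (rule dense_le)
  then have "ereal (lower_density J * ln 2) \<le> ereal (entropy_part \<mu> f {P, - P})"
    by (simp add: le_divide_eq)
  also have "\<dots> \<le> metric_entropy \<mu> f"
    by (rule A.entropy_part_le_metric_entropy[OF sqA])
  finally show "ereal (lower_density J * ln 2) \<le> metric_entropy \<mu> f" .
qed

end
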